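(* Let $(a_{k,l})_{k,l\ge 1}$ be independent and identically distributed real random variables with $\mathbb E[a_{1,1}]=0$ and $\mathbb E[a_{1,1}^2]=1$, and for $n\ge 1$ let $$F_n(x,y)=\frac1n\sum_{1\le i,j\le n}a_{i,j}\cos\left(\frac{ix}{n}\right)\cos\left(\frac{jy}{n}\right),\qquad (x,y)\in\mathbb R^2 .$$ For integers $0\le k,l\le n-1$, let $l_{n,k,l}$ denote the length of the nodal set of $F_n$ inside the square $[k\pi,(k+1)\pi]\times[l\pi,(l+1)\pi]$. Then there exist $\alpha>0$ and $C>0$ such that $$\sup_{n\ge1}\ \sup_{0\le k,l\le n-1}\mathbb E\left[l_{n,k,l}^{1+\alpha}\right]\le C.$$
   Context: The nodal set of $F_n$ inside a compact set $K\subset\mathbb R^2$ is $\{(x,y)\in K:\ F_n(x,y)=0\}$, and its length is its $1$-dimensional Hausdorff measure.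
   Formalization: The expectation is taken only over the event that F_n is not identically zero; otherwise, if a_{1,1} vanishes with positive probability, the nodal set is the whole square with positive probability and the expectation is infinite. *)

theory Defs
  imports "HOL-Probability.Probability"
begin

text \<open>One-dimensional Hausdorff (outer) measure in a metric space. Covering sets are required to be
  bounded because \<^const>\<open>diameter\<close> is meaningless otherwise. On the type \<^typ>\<open>real \<times> real\<close>
  the metric is the Euclidean one.\<close>

definition hausdorff1_pre :: "real \<Rightarrow> 'a::metric_space set \<Rightarrow> ennreal" where
  "hausdorff1_pre \<delta> A =
     (INF U \<in> {U :: nat \<Rightarrow> 'a set. A \<subseteq> (\<Union>i. U i) \<and> (\<forall>i. bounded (U i) \<and> diameter (U i) \<le> \<delta>)}.
        \<Sum>i. ennreal (diameter (U i)))"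

definition hausdorff1 :: "'a::metric_space set \<Rightarrow> ennreal" where
  "hausdorff1 A = (SUP \<delta> \<in> {0<..}. hausdorff1_pre \<delta> A)"

definition nodal_set :: "(real \<times> real \<Rightarrow> real) \<Rightarrow> (real \<times> real) set \<Rightarrow> (real \<times> real) set" where
  "nodal_set f K = {p \<in> K. f p = 0}"

text \<open>The length of the nodal set of \<open>f = 0\<close> in a square is infinite. A random \<open>f\<close> may vanish
  identically with positive probability (if the coefficients have an atom at \<open>0\<close>), so expectations
  of lengths have to be taken on the event that \<open>f\<close> is not identically zero.\<close>

definition nodal_length :: "(real \<times> real \<Rightarrow> real) \<Rightarrow> (real \<times> real) set \<Rightarrow> ennreal" where
  "nodal_length f K = hausdorff1 (nodal_set f K)"

definition cos_poly :: "(nat \<Rightarrow> nat \<Rightarrow> real) \<Rightarrow> nat \<Rightarrow> real \<times> real \<Rightarrow> real" where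
  "cos_poly c n = (\<lambda>(x, y). 1 / real n *
     (\<Sum>i = 1..n. \<Sum>j = 1..n. c i j * cos (real i * x / real n) * cos (real j * y / real n)))"

definition pi_square :: "nat \<Rightarrow> nat \<Rightarrow> (real \<times> real) set" where
  "pi_square k l = {real k * pi .. (real k + 1) * pi} \<times> {real l * pi .. (real l + 1) * pi}"

text \<open>Real powers of extended non-negative reals, intended for exponents \<open>p > 0\<close>.\<close>

definition ennreal_powr :: "ennreal \<Rightarrow> real \<Rightarrow> ennreal" where
  "ennreal_powr x p = (if x = \<infinity> then \<infinity> else ennreal (enn2real x powr p))"

end

theory Submission imports Defs begin

text \<open>
  The exponent is \<open>\<alpha> = 1\<close>. Off finitely many horizontal and vertical lines the nodal set is a countable
  union of pieces of Lipschitz graphs over one of the axes, so its length in a square is at most three times the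
  integral of the number of zeros on vertical slices plus the same for horizontal slices. It
  remains to bound the second moment of the number \<open>N\<close> of zeros on a fixed slice, which is
  an interval of length \<open>pi\<close>.

  The restriction \<open>g\<close> of \<open>F\<^sub>n\<close> to the slice is a polynomial of degree \<open>n\<close> in a cosine, whence
  \<open>N \<le> n\<close>. If \<open>N \<ge> m\<close>, interpolation gives \<open>\<bar>g\<bar> \<le> pi ^ m / m! * sup \<bar>g\<^sup>(\<^sup>m\<^sup>)\<bar>\<close> on the whole slice. As all
  frequencies are at most \<open>1\<close>, all derivatives of \<open>g\<close> have second moments at most \<open>1\<close>, so apart from
  an event of probability \<open>O(4\<^sup>-\<^sup>m)\<close> both \<open>g\<close>-values at the endpoints of the slice are super-exponentially
  small. A Fourier argument at the scale of a single coefficient shows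
  that the probability of both values being at most \<open>r\<close> is \<open>O(r\<^sup>2 + n\<^sup>-\<^sup>2)\<close>, whatever the distribution of
  the coefficients. Summing \<open>(2 m - 1) P(N \<ge> m)\<close> over \<open>m \<le> n\<close>, the error \<open>n\<^sup>-\<^sup>2\<close> contributes \<open>O(1)\<close>. One
  endpoint would give only \<open>n\<^sup>-\<^sup>1\<close>, which does not suffice.
\<close>

section \<open>Length and slices\<close>

text \<open>The coefficients may be discrete, for instance random signs. Their characteristic
  function is controlled only near 0, and a single summand of F_n has size 1/n; this is where the
  floor of the small-ball bound comes from. Two obstacles shape the length estimate. F_n may vanish
  together with its gradient, so the nodal set need not be a union of smooth curves; at such points
  a higher y-derivative takes over the role of F_n. F_n may also vanish on whole lines parallel to
  an axis; there are finitely many of them in the range, which the slice integrals do not see, and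
  each of them is itself a Lipschitz graph over the other axis. The maximum of a random derivative
  over a slice is never estimated directly. All derivatives at one endpoint are controlled at once,
  with thresholds growing geometrically in the order, and the Taylor series carries the bound over
  to the slice. Measurability is required only of a majorant: the number of zeros is dominated by a
  count of explicit events, and the nonnegative integral is monotone for arbitrary
  functions.\<close>

lemma hausdorff1_pre_UN:
  fixes A :: "nat \<Rightarrow> 'a::metric_space set"
  shows "hausdorff1_pre d (\<Union>i. A i) \<le> (\<Sum>i. hausdorff1_pre d (A i))"
proof (rule ennreal_le_epsilon)
  fix e :: real assume fin: "(\<Sum>i. hausdorff1_pre d (A i)) < top" and e: "0 < e"
  have finA: "hausdorff1_pre d (A i) < top" for i
    using fin by (metis ennreal_suminf_lessD)
  have "\<exists>U. A i \<subseteq> (\<Union>j. U j) \<and> (\<forall>j. bounded (U j) \<and> diameter (U j) \<le> d) \<and>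
      (\<Sum>j. ennreal (diameter (U j))) \<le> hausdorff1_pre d (A i) + ennreal (e * (1/2) ^ Suc i)" for i
  proof -
    have "hausdorff1_pre d (A i) < hausdorff1_pre d (A i) + ennreal (e * (1/2) ^ Suc i)"
      using finA[of i] e by (simp add: ennreal_add_left_cancel_less)
    then obtain U where "U \<in> {U :: nat \<Rightarrow> 'a set. A i \<subseteq> (\<Union>i. U i) \<and> (\<forall>i. bounded (U i) \<and> diameter (U i) \<le> d)}"
       "(\<Sum>j. ennreal (diameter (U j))) < hausdorff1_pre d (A i) + ennreal (e * (1/2) ^ Suc i)"
      unfolding hausdorff1_pre_def INF_less_iff by blast
    then show ?thesis by (intro exI[of _ U]) auto
  qed
  then obtain U where U: "\<And>i. A i \<subseteq> (\<Union>j. U i j)" "\<And>i j. bounded (U i j)" "\<And>i j. diameter (U i j) \<le> d"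
    and Us: "\<And>i. (\<Sum>j. ennreal (diameter (U i j))) \<le> hausdorff1_pre d (A i) + ennreal (e * (1/2) ^ Suc i)"
    by metis
  let ?V = "\<lambda>k. case_prod U (prod_decode k)"
  have cov: "(\<Union>i. A i) \<subseteq> (\<Union>k. ?V k)"
  proof
    fix x assume "x \<in> (\<Union>i. A i)"
    then obtain i j where "x \<in> U i j" using U(1) by blast
    then have "x \<in> ?V (prod_encode (i, j))" by simp
    then show "x \<in> (\<Union>k. ?V k)" by (rule UN_I[OF UNIV_I])
  qed
  have "hausdorff1_pre d (\<Union>i. A i) \<le> (\<Sum>k. ennreal (diameter (?V k)))"
    unfolding hausdorff1_pre_def[of d "\<Union>i. A i"]
  proof (intro INF_lower CollectI conjI allI)
    show "bounded (?V k)" "diameter (?V k) \<le> d" for k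
      using U(2,3) by (simp_all add: case_prod_beta)
  qed (rule cov)
  also have "\<dots> = (\<Sum>k. (\<lambda>(i, j). ennreal (diameter (U i j))) (prod_decode k))"
    by (simp add: case_prod_beta)
  also have "\<dots> = (\<Sum>i. \<Sum>j. ennreal (diameter (U i j)))"
    by (rule suminf_ennreal_2dimen) simp
  also have "\<dots> \<le> (\<Sum>i. hausdorff1_pre d (A i) + ennreal (e * (1/2) ^ Suc i))"
    by (intro suminf_le Us) auto
  also have "\<dots> = (\<Sum>i. hausdorff1_pre d (A i)) + (\<Sum>i. ennreal (e * (1/2) ^ Suc i))"
    by (rule suminf_add[symmetric]) auto
  also have "(\<Sum>i. ennreal (e * (1/2) ^ Suc i)) = ennreal e"
  proof -
    have "(\<lambda>i. e * (1/2) ^ Suc i) sums (e * 1)"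
      by (intro sums_mult power_half_series)
    then have "(\<lambda>i. e * (1/2) ^ Suc i) sums e" by (simp only: mult_1_right)
    then show ?thesis by (rule suminf_ennreal_eq[rotated]) (use e in simp)
  qed
  finally show "hausdorff1_pre d (\<Union>i. A i) \<le> (\<Sum>i. hausdorff1_pre d (A i)) + ennreal e" .
qed

lemma hausdorff1_UN:
  fixes A :: "nat \<Rightarrow> 'a::metric_space set"
  shows "hausdorff1 (\<Union>i. A i) \<le> (\<Sum>i. hausdorff1 (A i))"
  unfolding hausdorff1_def
proof (rule SUP_least)
  fix d :: real assume "d \<in> {0<..}"
  then show "hausdorff1_pre d (\<Union>i. A i) \<le> (\<Sum>i. \<Squnion>d\<in>{0<..}. hausdorff1_pre d (A i))"
    by (intro order_trans[OF hausdorff1_pre_UN] suminf_le) (auto intro: SUP_upper)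
qed

text \<open>Outer regularity yields an open \<open>U\<close> of almost the same measure, and
  non-overlapping intervals inside \<open>U\<close> have total length at most that of
  \<open>U\<close>. The bound \<open>d\<close> on each length makes the cover usable for Hausdorff
  measure at scale \<open>d\<close>.\<close>

lemma small_interval_cover:
  fixes S :: "real set"
  assumes S: "S \<in> sets borel" "bounded S" and d: "0 < d" and e: "0 < e"
  obtains c :: "nat \<Rightarrow> real" and w :: "nat \<Rightarrow> real"
  where "S \<subseteq> (\<Union>i. {c i..c i + w i})" "\<And>i. 0 \<le> w i" "\<And>i. w i \<le> d"
    "(\<Sum>i. ennreal (w i)) \<le> emeasure lborel S + ennreal e"
proof -
  obtain U where U: "open U" "S \<subseteq> U" "emeasure lborel (U - S) < e"
    using outer_regular_lborel[OF S(1) e] by blast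
  obtain b where b: "b > 0" "S \<subseteq> {-b..b}"
    using S(2) bounded_pos[of S] by (force simp: abs_le_iff)
  define r where "r x = (SOME r. r > 0 \<and> ball x r \<subseteq> U)" for x
  have r: "r x > 0 \<and> ball x (r x) \<subseteq> U" if "x \<in> U" for x
    unfolding r_def using U(1) that by (rule_tac someI_ex) (meson open_contains_ball)
  \<comment> \<open>The tags of the covering lemma lie in \<open>S\<close>, hence in
    \<open>U\<close>. There the radius forces an interval to stay in \<open>U\<close> and to have
    length at most \<open>d\<close>; at other points any ball makes \<open>g\<close> a
    gauge.\<close>
  define g where "g x = (if x \<in> U then ball x (min (d/2) (r x)) else ball x 1)" for x
  have g: "gauge g"
    unfolding gauge_def g_def using r d by auto
  obtain D where D: "countable D" "\<Union>D \<subseteq> cbox (-b) b"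
    "\<And>K. K \<in> D \<Longrightarrow> interior K \<noteq> {} \<and> (\<exists>c d. K = cbox c d)"
    "pairwise (\<lambda>A B. interior A \<inter> interior B = {}) D"
    "\<And>K. K \<in> D \<Longrightarrow> \<exists>x \<in> S \<inter> K. K \<subseteq> g x" "S \<subseteq> \<Union>D"
  proof (rule covering_lemma[of S "-b" b g])
    show "S \<subseteq> cbox (-b) b" "box (-b) b \<noteq> {}" "gauge g" using b g by auto
  qed blast
  have D': "\<exists>c w. K = {c..c+w} \<and> 0 \<le> w \<and> w \<le> d \<and> K \<subseteq> U" if KD: "K \<in> D" for K
  proof -
    obtain c e where K: "K = {c..e}" "c \<le> e" using D(3)[OF KD] by (force simp: cbox_interval)
    obtain x where x: "x \<in> S" "K \<subseteq> g x" using D(5)[OF KD] by auto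
    then have xU: "x \<in> U" using U by auto
    have "g x = ball x (d/2) \<inter> ball x (r x)" using xU by (auto simp: g_def)
    then have sub: "K \<subseteq> ball x (d/2)" "K \<subseteq> U" using x r[OF xU] by blast+
    have "c \<in> ball x (d/2)" "e \<in> ball x (d/2)" using sub K by auto
    then have "\<bar>x - c\<bar> < d/2" "\<bar>x - e\<bar> < d/2" by (simp_all add: dist_real_def)
    then have "e - c \<le> d" by linarith
    then show ?thesis using K sub by (intro exI[of _ c] exI[of _ "e - c"]) auto
  qed
  \<comment> \<open>\<open>D\<close> may be finite or empty, so the sequence is padded with empty
    sets. Its non-empty members have to be distinct, or their lengths would be counted
    repeatedly.\<close>
  have "\<exists>f :: nat \<Rightarrow> real set. range f \<subseteq> insert {} D \<and> D \<subseteq> range f \<and> (\<forall>i j. i \<noteq> j \<longrightarrow> f i \<noteq> {} \<longrightarrow> f i \<noteq> f j)"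
  proof -
    let ?f = "\<lambda>n. if n \<in> to_nat_on D ` D then from_nat_into D n else {}"
    have 1: "range ?f \<subseteq> insert {} D" using D(1) by auto
    have 2: "D \<subseteq> range ?f"
    proof
      fix K assume "K \<in> D"
      then have "K = ?f (to_nat_on D K)" using D(1) by simp
      then show "K \<in> range ?f" by (rule range_eqI)
    qed
    have 3: "?f i \<noteq> ?f j" if ij: "i \<noteq> j" and ne: "?f i \<noteq> {}" for i j
    proof
      assume eq: "?f i = ?f j"
      have i: "i \<in> to_nat_on D ` D" and j: "j \<in> to_nat_on D ` D" using ne eq by presburger+
      then have "from_nat_into D i = from_nat_into D j" using eq by simp
      then show False using i j ij D(1) by auto
    qed
    show ?thesis
    proof (intro exI[of _ ?f] conjI allI impI)
      show "range ?f \<subseteq> insert {} D" by (rule 1)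
      show "D \<subseteq> range ?f" by (rule 2)
      show "?f i \<noteq> ?f j" if "i \<noteq> j" "?f i \<noteq> {}" for i j using 3[OF that] .
    qed
  qed
  then obtain f :: "nat \<Rightarrow> real set" where f: "range f \<subseteq> insert {} D" "D \<subseteq> range f"
    "\<And>i j. i \<noteq> j \<Longrightarrow> f i \<noteq> {} \<Longrightarrow> f i \<noteq> f j" by blast
  define c where "c i = (if f i = {} then 0 else Inf (f i))" for i
  define w where "w i = (if f i = {} then 0 else Sup (f i) - Inf (f i))" for i
  have fi: "f i = {c i..c i + w i} \<and> 0 \<le> w i \<and> w i \<le> d \<and> f i \<subseteq> U" if ne: "f i \<noteq> {}" for i
  proof -
    have "f i \<in> D" using f(1) ne by auto
    from D'[OF this] obtain a v where "f i = {a..a+v}" "0 \<le> v" "v \<le> d" "f i \<subseteq> U" by blast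
    then show ?thesis using ne by (simp add: c_def w_def)
  qed
  have w0: "0 \<le> w i \<and> w i \<le> d" for i
  proof (cases "f i = {}")
    case True then show ?thesis using d by (simp add: w_def)
  next
    case False then show ?thesis using fi by blast
  qed
  have cov: "S \<subseteq> (\<Union>i. {c i..c i + w i})"
  proof
    fix x assume "x \<in> S"
    then obtain i where "x \<in> f i" using D(6) f(2) by blast
    then have "x \<in> {c i..c i + w i}" using fi[of i] by blast
    then show "x \<in> (\<Union>i. {c i..c i + w i})" by blast
  qed
  \<comment> \<open>Neighbouring intervals may share endpoints; only the interiors are disjoint, and
    they have the same lengths.\<close>
  define h where "h i = (if f i = {} then {} else {c i<..<c i + w i})" for i
  have hi: "h i = interior (f i)" for i
  proof (cases "f i = {}")
    case False
    then have "interior (f i) = interior {c i..c i + w i}" using fi[of i] by (intro arg_cong[where f=interior]) blast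
    then show ?thesis using False by (simp add: h_def interior_atLeastAtMost_real)
  qed (simp add: h_def)
  have disj: "disjoint_family h"
    unfolding disjoint_family_on_def
  proof (intro ballI impI)
    fix i j :: nat assume ij: "i \<noteq> j"
    show "h i \<inter> h j = {}"
    proof (cases "f i = {} \<or> f j = {}")
      case True then show ?thesis by (auto simp: h_def)
    next
      case False
      then have "f i \<in> D" "f j \<in> D" "f i \<noteq> f j" using f ij by auto
      then show ?thesis unfolding hi using D(4) unfolding pairwise_def by blast
    qed
  qed
  have hU: "(\<Union>i. h i) \<subseteq> U" 
  proof (rule UN_least)
    fix i show "h i \<subseteq> U" unfolding hi using fi[of i] interior_subset[of "f i"] by (cases "f i = {}") auto
  qed
  have "emeasure lborel (h i) = ennreal (w i)" for i
    using w0[of i] by (cases "f i = {}") (simp_all add: h_def w_def)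
  then have "(\<Sum>i. ennreal (w i)) = (\<Sum>i. emeasure lborel (h i))" by simp
  also have "\<dots> = emeasure lborel (\<Union>i. h i)"
  proof (rule suminf_emeasure[OF _ disj])
    show "range h \<subseteq> sets lborel" unfolding hi by (auto intro!: borel_open)
  qed
  also have "\<dots> \<le> emeasure lborel U"
    by (intro emeasure_mono hU) (simp add: U(1))
  also have "\<dots> = emeasure lborel S + emeasure lborel (U - S)"
  proof -
    have "S \<union> (U - S) = U" using U(2) by blast
    then show ?thesis using U(1) S(1) plus_emeasure[of S lborel "U - S"] by simp
  qed
  also have "\<dots> \<le> emeasure lborel S + ennreal e"
    by (intro add_left_mono less_imp_le U(3))
  finally have le: "(\<Sum>i. ennreal (w i)) \<le> emeasure lborel S + ennreal e" .
  show ?thesis by (rule that[OF cov conjunct1[OF w0] conjunct2[OF w0] le])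
qed

text \<open>The constant 2 leaves slack over slope 1, so that the two open slope conditions overlap
  and cover all directions. With \<open>dist_pair_le\<close> it becomes the factor 3 of the length
  bound.\<close>

definition xlip :: "(real \<times> real) set \<Rightarrow> bool" where
  "xlip E \<longleftrightarrow> (\<forall>p\<in>E. \<forall>q\<in>E. \<bar>snd p - snd q\<bar> \<le> 2 * \<bar>fst p - fst q\<bar>)"

definition ylip :: "(real \<times> real) set \<Rightarrow> bool" where
  "ylip E \<longleftrightarrow> (\<forall>p\<in>E. \<forall>q\<in>E. \<bar>fst p - fst q\<bar> \<le> 2 * \<bar>snd p - snd q\<bar>)"

text \<open>A cover of the image by short intervals pulls back to a cover of \<open>E\<close> by
  sets whose diameter is at most three times the length; \<open>d/3\<close> and \<open>e/3\<close>
  compensate for this factor.\<close>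

lemma hausdorff1_le_projection:
  fixes E :: "(real \<times> real) set" and \<pi> :: "real \<times> real \<Rightarrow> real"
  assumes dist: "\<And>p q. p \<in> E \<Longrightarrow> q \<in> E \<Longrightarrow> dist p q \<le> 3 * \<bar>\<pi> p - \<pi> q\<bar>"
    and S: "\<pi> ` E \<in> sets borel" "bounded (\<pi> ` E)"
  shows "hausdorff1 E \<le> 3 * emeasure lborel (\<pi> ` E)"
  unfolding hausdorff1_def
proof (rule SUP_least)
  fix d :: real assume "d \<in> {0<..}"
  then have d: "d > 0" by simp
  show "hausdorff1_pre d E \<le> 3 * emeasure lborel (\<pi> ` E)"
  proof (rule ennreal_le_epsilon)
    fix e :: real assume e: "0 < e"
    obtain c w where cw: "\<pi> ` E \<subseteq> (\<Union>i. {c i..c i + w i})" "\<And>i::nat. 0 \<le> w i" "\<And>i. w i \<le> d/3"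
      "(\<Sum>i. ennreal (w i)) \<le> emeasure lborel (\<pi> ` E) + ennreal (e/3)"
    proof (rule small_interval_cover[OF S, of "d/3" "e/3"])
      show "0 < d/3" "0 < e/3" using d e by auto
    qed blast
    define U where "U i = E \<inter> \<pi> -` {c i..c i + w i}" for i
    have dU: "dist p q \<le> 3 * w i" if "p \<in> U i" "q \<in> U i" for p q i
    proof -
      have pq: "p \<in> E" "q \<in> E" "\<bar>\<pi> p - \<pi> q\<bar> \<le> w i" using that unfolding U_def by (simp_all, linarith)
      have "3 * \<bar>\<pi> p - \<pi> q\<bar> \<le> 3 * w i" using pq(3) by simp
      with dist[OF pq(1,2)] show ?thesis by (rule order_trans)
    qed
    have bU: "bounded (U i)" for i
    proof (cases "U i = {}")
      case False
      then obtain p where p: "p \<in> U i" by auto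
      have "U i \<subseteq> cball p (3 * w i)" using dU[OF p] unfolding cball_def by blast
      then show ?thesis using bounded_cball bounded_subset by blast
    qed simp
    have diam: "diameter (U i) \<le> 3 * w i" for i
      using dU[unfolded dist_norm] cw(2)[of i] by (intro diameter_le disjI2) simp_all
    have "hausdorff1_pre d E \<le> (\<Sum>i. ennreal (diameter (U i)))"
      unfolding hausdorff1_pre_def
    proof (intro INF_lower CollectI conjI allI)
      show "E \<subseteq> (\<Union>i. U i)" using cw(1) unfolding U_def by blast
      show "diameter (U i) \<le> d" for i using diam[of i] cw(3)[of i] by simp
    qed (rule bU)
    also have "\<dots> \<le> (\<Sum>i. 3 * ennreal (w i))"
      using diam cw(2) by (intro suminf_le) (auto simp: ennreal_mult[symmetric] ennreal_leI simp flip: ennreal_numeral)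
    also have "\<dots> = 3 * (\<Sum>i. ennreal (w i))" by simp
    also have "\<dots> \<le> 3 * (emeasure lborel (\<pi> ` E) + ennreal (e/3))"
      by (intro mult_left_mono cw) auto
    also have "\<dots> = 3 * emeasure lborel (\<pi> ` E) + ennreal e"
      using e by (simp add: distrib_left ennreal_mult[symmetric] flip: ennreal_numeral)
    finally show "hausdorff1_pre d E \<le> 3 * emeasure lborel (\<pi> ` E) + ennreal e" .
  qed
qed

section \<open>Projections and points in slices\<close>

lemma dist_pair_le: "dist (p :: real \<times> real) q \<le> \<bar>fst p - fst q\<bar> + \<bar>snd p - snd q\<bar>"
  unfolding dist_prod_def dist_real_def
  using sqrt_sum_squares_le_sum_abs[of "\<bar>fst p - fst q\<bar>" "\<bar>snd p - snd q\<bar>"] by simp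

text \<open>Projections of Borel sets need not be Borel. An F_sigma set in the plane, however, is a
  countable union of compact sets, whose images are compact.\<close>

lemma projections_measurable_of_fsigma:
  fixes E :: "(real \<times> real) set"
  assumes "fsigma_in euclidean E"
  shows "fst ` E \<in> sets borel" "snd ` E \<in> sets borel"
proof -
  obtain C :: "nat \<Rightarrow> (real \<times> real) set" where C: "\<And>n. closed (C n)" "E = (\<Union>n. C n)"
    using assms unfolding fsigma_in_ascending by auto
  have E: "E = (\<Union>n. \<Union>k::nat. C n \<inter> cball 0 (real k))"
    unfolding C(2) using real_arch_simple by fastforce
  have comp: "compact (C n \<inter> cball 0 (real k))" for n k
    using C(1) by (simp add: closed_Int_compact)
  have "fst ` E = (\<Union>n. \<Union>k::nat. fst ` (C n \<inter> cball 0 (real k)))"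
    by (subst E) blast
  moreover have "fst ` (C n \<inter> cball 0 (real k)) \<in> sets borel" for n k
    by (intro borel_closed compact_imp_closed compact_continuous_image comp continuous_intros)
  ultimately show "fst ` E \<in> sets borel" by auto
  have "snd ` E = (\<Union>n. \<Union>k::nat. snd ` (C n \<inter> cball 0 (real k)))"
    by (subst E) blast
  moreover have "snd ` (C n \<inter> cball 0 (real k)) \<in> sets borel" for n k
    by (intro borel_closed compact_imp_closed compact_continuous_image comp continuous_intros)
  ultimately show "snd ` E \<in> sets borel" by auto
qed

text \<open>If \<open>x\<close> lies in the images of several disjoint pieces, then choosing one
  point in each gives as many distinct points of \<open>Z\<close> over \<open>x\<close>. The
  hypothesis speaks of finite subsets of the slice because \<open>card\<close> of an infinite slice
  would be 0.\<close>

lemma suminf_projection_le: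
  fixes D :: "nat \<Rightarrow> 'a set" and \<pi> :: "'a \<Rightarrow> real" and f :: "real \<Rightarrow> ennreal"
  assumes disj: "disjoint_family D" and D: "\<And>i. D i \<subseteq> Z" "\<And>i. \<pi> ` D i \<in> sets borel"
    and f: "AE x in lborel. \<forall>Y. finite Y \<longrightarrow> Y \<subseteq> {p \<in> Z. \<pi> p = x} \<longrightarrow> of_nat (card Y) \<le> f x"
  shows "(\<Sum>i. emeasure lborel (\<pi> ` D i)) \<le> (\<integral>\<^sup>+x. f x \<partial>lborel)"
proof -
  have "(\<Sum>i. emeasure lborel (\<pi> ` D i)) = (\<Sum>i. \<integral>\<^sup>+x. indicator (\<pi> ` D i) x \<partial>lborel)"
    using D by simp
  also have "\<dots> = (\<integral>\<^sup>+x. (\<Sum>i. indicator (\<pi> ` D i) x) \<partial>lborel)"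
    using D by (intro nn_integral_suminf[symmetric]) auto
  also have "\<dots> \<le> (\<integral>\<^sup>+x. f x \<partial>lborel)"
    using f
  proof (intro nn_integral_mono_AE, eventually_elim)
    case (elim x)
    have "(\<Sum>i<k. indicator (\<pi> ` D i) x) \<le> f x" for k
    proof -
      define I where "I = {i. i < k \<and> x \<in> \<pi> ` D i}"
      have "\<forall>i\<in>I. \<exists>p. p \<in> D i \<and> \<pi> p = x" by (auto simp: I_def)
      then obtain p where p: "\<And>i. i \<in> I \<Longrightarrow> p i \<in> D i \<and> \<pi> (p i) = x" by metis
      have "inj_on p I"
        using p disj unfolding inj_on_def disjoint_family_on_def by (metis IntI UNIV_I empty_iff)
      moreover have "finite (p ` I)" by (simp add: I_def)
      moreover have "p ` I \<subseteq> {p \<in> Z. \<pi> p = x}" using p D(1) by blast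
      ultimately have "of_nat (card I) \<le> f x" using elim by (metis card_image)
      moreover have "(\<Sum>i<k. indicator (\<pi> ` D i) x) = (of_nat (card I) :: ennreal)"
      proof -
        have "(\<Sum>i<k. indicator (\<pi> ` D i) x :: ennreal) = (\<Sum>i\<in>{..<k}. if i \<in> I then 1 else 0)"
          by (intro sum.cong) (auto simp: I_def indicator_def)
        also have "\<dots> = of_nat (card ({..<k} \<inter> I))" by (simp add: sum.If_cases)
        also have "{..<k} \<inter> I = I" by (auto simp: I_def)
        finally show ?thesis .
      qed
      ultimately show ?thesis by simp
    qed
    then show ?case by (intro suminf_le_const) auto
  qed
  finally show ?thesis .
qed

text \<open>Cutting \<open>Z\<close> into countably many disjoint pieces, each with a Lipschitz inverse of one of the two
  projections, reduces the length to the measures of the projections, and these add up to at most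
  the number of points in the slices. The sets \<open>C \<inter> B\<close> with \<open>B\<close> from a countable basis are Boolean
  combinations of open and closed sets; this keeps the pieces \<open>F\<^sub>\<sigma>\<close> and hence their projections Borel.\<close>

lemma hausdorff1_le_slices:
  fixes Z :: "(real \<times> real) set" and f g :: "real \<Rightarrow> ennreal"
  assumes Z: "compact Z"
    and \<C>: "countable \<C>" "\<And>C. C \<in> \<C> \<Longrightarrow> closed C"
    and loc: "\<And>p. p \<in> Z \<Longrightarrow> \<exists>C\<in>\<C>. p \<in> C \<and> (\<exists>r>0. xlip (C \<inter> ball p r) \<or> ylip (C \<inter> ball p r))"
    and f: "AE x in lborel. \<forall>Y. finite Y \<longrightarrow> Y \<subseteq> {p \<in> Z. fst p = x} \<longrightarrow> of_nat (card Y) \<le> f x"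
    and g: "AE y in lborel. \<forall>Y. finite Y \<longrightarrow> Y \<subseteq> {p \<in> Z. snd p = y} \<longrightarrow> of_nat (card Y) \<le> g y"
  shows "hausdorff1 Z \<le> 3 * (\<integral>\<^sup>+x. f x \<partial>lborel) + 3 * (\<integral>\<^sup>+y. g y \<partial>lborel)"
proof -
  obtain \<B> :: "(real \<times> real) set set" where \<B>: "countable \<B>" "topological_basis \<B>"
    using ex_countable_basis by blast
  \<comment> \<open>The empty set is included so that there is something to enumerate even if
    \<open>Z\<close> is empty.\<close>
  define \<E> where "\<E> = insert {} {Z \<inter> C \<inter> B |C B. C \<in> \<C> \<and> B \<in> \<B> \<and> (xlip (C \<inter> B) \<or> ylip (C \<inter> B))}"
  have "\<E> \<subseteq> insert {} ((\<lambda>(C, B). Z \<inter> C \<inter> B) ` (\<C> \<times> \<B>))" unfolding \<E>_def by force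
  then have cE: "countable \<E>"
    by (rule countable_subset) (use \<C>(1) \<B>(1) in auto)
  define E where "E = from_nat_into \<E>"
  have rE: "range E = \<E>" unfolding E_def using cE by (intro range_from_nat_into) (auto simp: \<E>_def)
  have lip: "xlip (E i) \<or> ylip (E i)" for i
  proof -
    have "E i \<in> \<E>" using rE by blast
    then show ?thesis unfolding \<E>_def xlip_def ylip_def by fastforce
  qed
  have EZ: "E i \<subseteq> Z" for i
  proof -
    have "E i \<in> \<E>" using rE by blast
    then show ?thesis unfolding \<E>_def by auto
  qed
  have UE: "(\<Union>i. E i) = Z"
  proof
    show "(\<Union>i. E i) \<subseteq> Z" using EZ by blast
    show "Z \<subseteq> (\<Union>i. E i)"
    proof
      fix p assume p: "p \<in> Z"
      then obtain C r where C: "C \<in> \<C>" "p \<in> C" "r > 0" "xlip (C \<inter> ball p r) \<or> ylip (C \<inter> ball p r)"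
        using loc by blast
      obtain B where B: "B \<in> \<B>" "p \<in> B" "B \<subseteq> ball p r"
        using topological_basisE[OF \<B>(2) open_ball, of p p r] C(3) by auto
      have "xlip (C \<inter> B) \<or> ylip (C \<inter> B)" using C(4) B(3) unfolding xlip_def ylip_def by blast
      then have "Z \<inter> C \<inter> B \<in> \<E>" unfolding \<E>_def using C B by blast
      then obtain i where "E i = Z \<inter> C \<inter> B" using rE by (metis imageE)
      then have "p \<in> E i" using p C B by simp
      then show "p \<in> (\<Union>i. E i)" by blast
    qed
  qed
  \<comment> \<open>Sets that are both F_sigma and G_delta form an algebra, whereas F_sigma sets
    alone are not closed under the differences taken by \<open>disjointed\<close>.\<close>
  define \<A> where "\<A> A \<longleftrightarrow> fsigma_in euclidean A \<and> fsigma_in euclidean (- A)" for A :: "(real \<times> real) set"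
  have open_fs: "fsigma_in euclidean A" if "open A" for A :: "(real \<times> real) set"
    using that by (intro open_imp_fsigma_in metrizable_space_euclidean) simp
  have closed_fs: "fsigma_in euclidean A" if "closed A" for A :: "(real \<times> real) set"
    using that by (intro closed_imp_fsigma_in) simp
  have \<A>_open: "\<A> A" if "open A" for A unfolding \<A>_def using that open_fs closed_fs by (auto simp: closed_Compl open_Compl)
  have \<A>_closed: "\<A> A" if "closed A" for A unfolding \<A>_def using that open_fs closed_fs by (auto simp: closed_Compl open_Compl)
  have \<A>_Int: "\<A> (A \<inter> B)" if "\<A> A" "\<A> B" for A B
    using that unfolding \<A>_def by (auto intro: fsigma_in_Int fsigma_in_Un)
  have \<A>_Compl: "\<A> (- A)" if "\<A> A" for A
    using that unfolding \<A>_def by auto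
  have \<A>_Un: "\<A> (A \<union> B)" if "\<A> A" "\<A> B" for A B
    using \<A>_Compl[OF \<A>_Int[OF \<A>_Compl[OF that(1)] \<A>_Compl[OF that(2)]]] by simp
  have \<A>_E: "\<A> (E i)" for i
  proof -
    have "E i \<in> \<E>" using rE by blast
    then consider "E i = {}" | C B where "E i = Z \<inter> C \<inter> B" "C \<in> \<C>" "B \<in> \<B>" unfolding \<E>_def by auto
    then show ?thesis
    proof cases
      case 1 then show ?thesis using \<A>_open[of "{}"] by simp
    next
      case 2
      then show ?thesis using Z \<C>(2) topological_basis_open[OF \<B>(2)]
        by (simp add: \<A>_Int \<A>_open \<A>_closed compact_imp_closed)
    qed
  qed
  define D where "D = disjointed E"
  have \<A>_UN: "\<A> (\<Union>i\<in>{0..<n}. E i)" for n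
  proof (induction n)
    case 0 then show ?case using \<A>_open[of "{}"] by simp
  next
    case (Suc n)
    have "(\<Union>i\<in>{0..<Suc n}. E i) = (\<Union>i\<in>{0..<n}. E i) \<union> E n"
      by (auto simp: less_Suc_eq)
    then show ?case using Suc \<A>_E \<A>_Un by simp
  qed
  have D_fs: "fsigma_in euclidean (D i)" for i
    unfolding D_def disjointed_def Diff_eq using \<A>_Int[OF \<A>_E \<A>_Compl[OF \<A>_UN]] by (simp add: \<A>_def)
  have DE: "D i \<subseteq> E i" for i unfolding D_def by (rule disjointed_subset)
  have DZ: "D i \<subseteq> Z" for i using DE EZ by blast
  have disj: "disjoint_family D" unfolding D_def by (rule disjoint_family_disjointed)
  have UD: "(\<Union>i. D i) = Z" unfolding D_def using UN_disjointed_eq UE by metis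
  have bD: "bounded (D i)" for i using DZ Z compact_imp_bounded bounded_subset by blast
  have HD: "hausdorff1 (D i) \<le> 3 * emeasure lborel (fst ` D i) + 3 * emeasure lborel (snd ` D i)" for i
  proof -
    note meas = projections_measurable_of_fsigma[OF D_fs[of i]]
    have "xlip (D i) \<or> ylip (D i)" using lip[of i] DE[of i] unfolding xlip_def ylip_def by blast
    then show ?thesis
    proof
      assume x: "xlip (D i)"
      have "dist p q \<le> 3 * \<bar>fst p - fst q\<bar>" if "p \<in> D i" "q \<in> D i" for p q
        using x that dist_pair_le[of p q] unfolding xlip_def by fastforce
      then have "hausdorff1 (D i) \<le> 3 * emeasure lborel (fst ` D i)"
        by (intro hausdorff1_le_projection meas bounded_fst bD) auto
      then show ?thesis by (simp add: add_increasing2)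
    next
      assume y: "ylip (D i)"
      have "dist p q \<le> 3 * \<bar>snd p - snd q\<bar>" if "p \<in> D i" "q \<in> D i" for p q
        using y that dist_pair_le[of p q] unfolding ylip_def by fastforce
      then have "hausdorff1 (D i) \<le> 3 * emeasure lborel (snd ` D i)"
        by (intro hausdorff1_le_projection meas bounded_snd bD) auto
      then show ?thesis by (simp add: add_increasing)
    qed
  qed
  have "hausdorff1 Z \<le> (\<Sum>i. hausdorff1 (D i))" using hausdorff1_UN[of D] UD by simp
  also have "\<dots> \<le> (\<Sum>i. 3 * emeasure lborel (fst ` D i) + 3 * emeasure lborel (snd ` D i))"
    by (intro suminf_le HD) auto
  also have "\<dots> = 3 * (\<Sum>i. emeasure lborel (fst ` D i)) + 3 * (\<Sum>i. emeasure lborel (snd ` D i))"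
    by (simp add: suminf_add[symmetric])
  also have "\<dots> \<le> 3 * (\<integral>\<^sup>+x. f x \<partial>lborel) + 3 * (\<integral>\<^sup>+y. g y \<partial>lborel)"
    using DZ projections_measurable_of_fsigma[OF D_fs]
    by (intro add_mono mult_left_mono suminf_projection_le[OF disj _ _ f] suminf_projection_le[OF disj _ _ g]) auto
  finally show ?thesis .
qed

section \<open>Zeros of cosine sums\<close>

text \<open>Real part of the exponential series in \<open>s\<close>; each power of the imaginary
  unit contributes a phase shift by \<open>pi / 2\<close>.\<close>

lemma cos_taylor_sums: "(\<lambda>k. cos (\<theta> + real k * pi / 2) * s ^ k / fact k) sums cos (\<theta> + s)"
proof -
  have "(\<lambda>k. exp (\<i> * complex_of_real \<theta>) * ((\<i> * complex_of_real s) ^ k /\<^sub>R fact k)) sums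
      (exp (\<i> * complex_of_real \<theta>) * exp (\<i> * complex_of_real s))"
    by (intro sums_mult exp_converges)
  then have "(\<lambda>k. Re (exp (\<i> * complex_of_real \<theta>) * ((\<i> * complex_of_real s) ^ k /\<^sub>R fact k))) sums
      Re (exp (\<i> * complex_of_real \<theta>) * exp (\<i> * complex_of_real s))"
    by (rule sums_Re)
  moreover have "Re (exp (\<i> * complex_of_real \<theta>) * exp (\<i> * complex_of_real s)) = cos (\<theta> + s)"
    by (simp flip: cis_conv_exp add: cis_mult)
  moreover have "Re (exp (\<i> * complex_of_real \<theta>) * ((\<i> * complex_of_real s) ^ k /\<^sub>R fact k)) =
      cos (\<theta> + real k * pi / 2) * s ^ k / fact k" for k
  proof -
    have ik: "\<i> ^ k = cis (real k * (pi / 2))"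
      using Complex.DeMoivre[of "pi/2" k] by simp
    have "exp (\<i> * complex_of_real \<theta>) * ((\<i> * complex_of_real s) ^ k /\<^sub>R fact k) =
        (s ^ k / fact k) *\<^sub>R (cis \<theta> * \<i> ^ k)"
      by (simp flip: cis_conv_exp add: power_mult_distrib scaleR_conv_of_real field_simps)
    also have "cis \<theta> * \<i> ^ k = cis (\<theta> + real k * pi / 2)"
      unfolding ik by (simp add: cis_mult)
    finally show ?thesis by simp
  qed
  ultimately show ?thesis by simp
qed

text \<open>Since the \<open>m\<close>-th derivative of \<open>cos\<close> is \<open>\<lambda>t. cos (t + m * pi / 2)\<close>, this is the \<open>m\<close>-th derivative
  of \<open>\<lambda>y. \<Sum>j = 1..n. b j * cos (j * y / n)\<close>.\<close>

definition cos_sum_deriv :: "(nat \<Rightarrow> real) \<Rightarrow> nat \<Rightarrow> nat \<Rightarrow> real \<Rightarrow> real" where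
  "cos_sum_deriv b n m y = (\<Sum>j = 1..n. b j * (real j / real n) ^ m * cos (real j * y / real n + real m * pi / 2))"

section \<open>Derivatives and Taylor expansion of cosine sums\<close>

lemma cos_sum_deriv_deriv: "(cos_sum_deriv b n m has_real_derivative cos_sum_deriv b n (Suc m) y) (at y)"
proof -
  have shift: "cos (t + real (Suc m) * pi / 2) = - sin (t + real m * pi / 2)" for t
  proof -
    have "t + real (Suc m) * pi / 2 = (t + real m * pi / 2) + pi / 2" by (simp add: field_simps)
    then show ?thesis by (simp only: cos_add) simp
  qed
  show ?thesis unfolding cos_sum_deriv_def shift
    by (auto intro!: derivative_eq_intros sum.cong simp: field_simps)
qed

lemma cos_sum_deriv_taylor: "(\<lambda>k. cos_sum_deriv b n (m + k) y * h ^ k / fact k) sums cos_sum_deriv b n m (y + h)"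
proof -
  have "(\<lambda>k. \<Sum>j = 1..n. b j * (real j / real n) ^ m *
      (cos ((real j * y / real n + real m * pi / 2) + real k * pi / 2) * (real j / real n * h) ^ k / fact k)) sums
     (\<Sum>j = 1..n. b j * (real j / real n) ^ m *
      cos ((real j * y / real n + real m * pi / 2) + real j / real n * h))"
    by (intro sums_sum sums_mult cos_taylor_sums)
  moreover have "(\<Sum>j = 1..n. b j * (real j / real n) ^ m *
      (cos ((real j * y / real n + real m * pi / 2) + real k * pi / 2) * (real j / real n * h) ^ k / fact k)) =
      cos_sum_deriv b n (m + k) y * h ^ k / fact k" for k
    unfolding cos_sum_deriv_def sum_distrib_right sum_divide_distrib
  proof (intro sum.cong refl)
    fix j
    have "(real j * y / real n + real m * pi / 2) + real k * pi / 2 = real j * y / real n + real (m + k) * pi / 2"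
      by (simp add: field_simps)
    then show "b j * (real j / real n) ^ m *
      (cos ((real j * y / real n + real m * pi / 2) + real k * pi / 2) * (real j / real n * h) ^ k / fact k) =
      b j * (real j / real n) ^ (m + k) * cos (real j * y / real n + real (m + k) * pi / 2) * h ^ k / fact k"
      by (simp only: power_add power_mult_distrib) (simp add: mult_ac)
  qed
  moreover have "(\<Sum>j = 1..n. b j * (real j / real n) ^ m *
      cos ((real j * y / real n + real m * pi / 2) + real j / real n * h)) = cos_sum_deriv b n m (y + h)"
    unfolding cos_sum_deriv_def
  proof (intro sum.cong refl)
    fix j
    have "(real j * y / real n + real m * pi / 2) + real j / real n * h = real j * (y + h) / real n + real m * pi / 2"
      by (simp add: add_divide_distrib distrib_left)
    then show "b j * (real j / real n) ^ m * cos ((real j * y / real n + real m * pi / 2) + real j / real n * h) =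
       b j * (real j / real n) ^ m * cos (real j * (y + h) / real n + real m * pi / 2)" by (simp only:)
  qed
  ultimately show ?thesis by simp
qed

lemma cos_sum_deriv_eq_0_if_all_derivs_0:
  assumes "\<And>k. cos_sum_deriv b n k y0 = 0"
  shows "cos_sum_deriv b n 0 y = 0"
proof -
  have "(\<lambda>k. cos_sum_deriv b n (0 + k) y0 * (y - y0) ^ k / fact k) sums cos_sum_deriv b n 0 (y0 + (y - y0))"
    by (rule cos_sum_deriv_taylor)
  then show ?thesis using assms sums_unique2[OF sums_zero, of "cos_sum_deriv b n 0 y"] by simp
qed

section \<open>Rolle's theorem, interpolation and the number of zeros\<close>

lemma rolle_card:
  fixes f f' :: "real \<Rightarrow> real"
  assumes der: "\<And>x. (f has_real_derivative f' x) (at x)"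
    and Z: "finite Z" "Z \<noteq> {}" "\<And>z. z \<in> Z \<Longrightarrow> f z = 0"
  shows "\<exists>W. finite W \<and> Suc (card W) = card Z \<and> W \<subseteq> {Min Z..<Max Z} \<and> (\<forall>w\<in>W. f' w = 0)"
  using Z
proof (induction Z rule: finite_linorder_max_induct)
  case (insert b A)
  show ?case
  proof (cases "A = {}")
    case True then show ?thesis by (intro exI[of _ "{}"]) auto
  next
    case False
    then obtain W where W: "finite W" "Suc (card W) = card A" "W \<subseteq> {Min A..<Max A}" "\<forall>w\<in>W. f' w = 0"
      using insert.IH insert.prems by auto
    have lt: "Max A < b" using False insert by simp
    have "\<exists>z. Max A < z \<and> z < b \<and> DERIV f z :> 0"
    proof (rule Rolle[OF lt])
      show "f (Max A) = f b" using insert.prems insert.hyps False by simp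
      show "continuous_on {Max A..b} f"
        using der by (meson DERIV_isCont continuous_at_imp_continuous_on)
      show "f differentiable at x" for x using der real_differentiable_def by blast
    qed
    then obtain z where z: "Max A < z" "z < b" "DERIV f z :> 0" by blast
    then have "f' z = 0" using der DERIV_unique by blast
    \<comment> \<open>Confining \<open>W\<close> to the span of \<open>A\<close> is what makes the
      induction work: the new zero lies to the right of \<open>Max A\<close>, hence is not already
      in \<open>W\<close>.\<close>
    have zW: "z \<notin> W" using W(3) z by auto
    have bA: "b \<notin> A" using insert.hyps by auto
    have mM: "Min A \<le> Max A" using insert.hyps False by simp
    then have mm: "Min (insert b A) = Min A" "Max (insert b A) = b"
      using insert.hyps False lt by simp_all
    have "insert z W \<subseteq> {Min A..<b}" using W(3) z mM lt by fastforce
    then show ?thesis unfolding mm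
      using W(1,2,4) zW \<open>f' z = 0\<close> bA insert.hyps
      by (intro exI[of _ "insert z W"]) simp
  qed
qed simp

lemma iterated_rolle:
  fixes g :: "nat \<Rightarrow> real \<Rightarrow> real"
  assumes "\<And>m x. (g m has_real_derivative g (Suc m) x) (at x)"
    and "finite Z" "card Z = Suc k" "Z \<subseteq> {a..b}" "\<And>z. z \<in> Z \<Longrightarrow> g 0 z = 0"
  shows "\<exists>\<xi>\<in>{a..b}. g k \<xi> = 0"
  using assms
proof (induction k arbitrary: g Z)
  case 0
  then obtain z where "Z = {z}" by (auto simp: card_Suc_eq)
  then show ?case using 0 by auto
next
  case (Suc k)
  have ne: "Z \<noteq> {}" using Suc.prems by auto
  obtain W where W: "finite W" "Suc (card W) = card Z" "W \<subseteq> {Min Z..<Max Z}" "\<forall>w\<in>W. g (Suc 0) w = 0"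
    using rolle_card[of "g 0" "g (Suc 0)" Z] Suc.prems ne by auto
  have "Min Z \<in> Z" "Max Z \<in> Z" using Suc.prems(2) ne by auto
  then have "Min Z \<in> {a..b}" "Max Z \<in> {a..b}" using Suc.prems(4) by blast+
  then have "W \<subseteq> {a..b}" using W(3) by fastforce
  then have "\<exists>\<xi>\<in>{a..b}. (\<lambda>m. g (Suc m)) k \<xi> = 0"
    using W Suc.prems by (intro Suc.IH[of "\<lambda>m. g (Suc m)" W]) auto
  then show ?case by simp
qed

text \<open>Error bound of Lagrange interpolation by the zero polynomial at the nodes \<open>Z\<close>.\<close>

lemma abs_le_of_zeros:
  fixes g :: "nat \<Rightarrow> real \<Rightarrow> real"
  assumes der: "\<And>m x. (g m has_real_derivative g (Suc m) x) (at x)"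
    and Z: "finite Z" "card Z = m" "Z \<subseteq> {a..b}" "\<And>z. z \<in> Z \<Longrightarrow> g 0 z = 0"
    and B: "\<And>t. t \<in> {a..b} \<Longrightarrow> \<bar>g m t\<bar> \<le> B" and x: "x \<in> {a..b}"
  shows "\<bar>g 0 x\<bar> \<le> B * (b - a) ^ m / fact m"
proof (cases "x \<in> Z")
  case True
  have "0 \<le> B" using B[OF x] by linarith
  then show ?thesis using Z(4)[OF True] x by simp
next
  case False
  define P where "P = (\<Prod>z\<in>Z. [:-z, 1:])"
  have "degree P = m" unfolding P_def using Z(2) by (subst degree_prod_eq_sum_degree) auto
  moreover have "lead_coeff P = 1" unfolding P_def lead_coeff_prod by simp
  moreover have "poly P x = (\<Prod>z\<in>Z. x - z)" unfolding P_def poly_prod by simp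
  moreover have "poly P z = 0" if "z \<in> Z" for z
    unfolding P_def poly_prod using that Z(1) by (intro prod_zero) auto
  ultimately have P: "degree P = m" "lead_coeff P = 1" "poly P x = (\<Prod>z\<in>Z. x - z)"
    "\<And>z. z \<in> Z \<Longrightarrow> poly P z = 0" by blast+
  have Px: "poly P x \<noteq> 0" unfolding P(3) using False Z(1) by auto
  \<comment> \<open>With this factor \<open>g - K * P\<close> vanishes at \<open>x\<close> as well
    as on \<open>Z\<close>. It thus has \<open>m + 1\<close> zeros, and some m-th derivative
    \<open>g m\<close> equals \<open>K * fact m\<close>, since \<open>P\<close> is monic of degree
    \<open>m\<close>.\<close>
  define K where "K = g 0 x / poly P x"
  define h where "h k t = g k t - K * poly ((pderiv ^^ k) P) t" for k t
  have "\<exists>\<xi>\<in>{a..b}. h m \<xi> = 0"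
  proof (rule iterated_rolle)
    show "(h k has_real_derivative h (Suc k) t) (at t)" for k t
      unfolding h_def by (auto intro!: derivative_eq_intros der)
    show "finite (insert x Z)" "card (insert x Z) = Suc m" "insert x Z \<subseteq> {a..b}"
      using Z False x by auto
    show "h 0 z = 0" if "z \<in> insert x Z" for z
      using that P(4) Z(4) Px by (auto simp: h_def K_def)
  qed
  then obtain \<xi> where \<xi>: "\<xi> \<in> {a..b}" "h m \<xi> = 0" by blast
  have "(pderiv ^^ m) P = [:fact m:]"
  proof (rule poly_eqI)
    fix i
    have "coeff P (i + m) = (if i = 0 then 1 else 0)"
      using P(1,2) by (auto simp: coeff_eq_0)
    then show "coeff ((pderiv ^^ m) P) i = coeff [:fact m:] i"
      by (cases i) (simp_all add: coeff_higher_pderiv pochhammer_fact)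
  qed
  then have "g m \<xi> = K * fact m" using \<xi>(2) by (simp add: h_def)
  then have "\<bar>K\<bar> * fact m \<le> B" using B[OF \<xi>(1)] by (simp add: abs_mult)
  then have K: "\<bar>K\<bar> \<le> B / fact m" by (simp add: field_simps)
  have "\<bar>poly P x\<bar> \<le> (b - a) ^ m"
  proof -
    have "\<bar>poly P x\<bar> = (\<Prod>z\<in>Z. \<bar>x - z\<bar>)" unfolding P(3) by (rule abs_prod)
    also have "\<dots> \<le> (\<Prod>z\<in>Z. b - a)"
    proof (intro prod_mono conjI)
      fix z assume "z \<in> Z"
      then have "z \<in> {a..b}" using Z(3) by blast
      then show "\<bar>x - z\<bar> \<le> b - a" using x by (auto simp: abs_if)
    qed simp
    finally show ?thesis using Z(2) by simp
  qed
  then have "\<bar>K\<bar> * \<bar>poly P x\<bar> \<le> B / fact m * (b - a) ^ m"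
    using K by (intro mult_mono) auto
  moreover have "\<bar>g 0 x\<bar> = \<bar>K\<bar> * \<bar>poly P x\<bar>" unfolding K_def using Px by (simp add: abs_divide)
  ultimately show ?thesis by simp
qed

text \<open>These are the Chebyshev polynomials of the first kind, built by their three-term
  recurrence.\<close>

lemma cos_multiple_poly: "\<exists>p :: real poly. degree p \<le> j \<and> (\<forall>t. cos (real j * t) = poly p (cos t))"
proof (induction j rule: induct_nat_012)
  case 0 show ?case by (intro exI[of _ 1]) auto
next
  case 1 show ?case by (intro exI[of _ "[:0, 1:]"]) auto
next
  case (ge2 j)
  then obtain p q :: "real poly" where p: "degree p \<le> j" "\<And>t. cos (real j * t) = poly p (cos t)"
    and q: "degree q \<le> Suc j" "\<And>t. cos (real (Suc j) * t) = poly q (cos t)" by blast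
  have "degree ([:0, 2:] * q) \<le> Suc (Suc j)"
    by (rule order_trans[OF degree_mult_le]) (use q(1) in auto)
  then have d: "degree ([:0, 2:] * q - p) \<le> Suc (Suc j)" using p(1) by (intro degree_diff_le) auto
  have "cos (real (Suc (Suc j)) * t) = poly ([:0, 2:] * q - p) (cos t)" for t
  proof -
    have "cos (real (Suc (Suc j)) * t) = 2 * cos t * cos (real (Suc j) * t) - cos (real j * t)"
    proof -
      have a: "real (Suc (Suc j)) * t = real (Suc j) * t + t" "real j * t = real (Suc j) * t - t"
        by (simp_all add: algebra_simps)
      show ?thesis unfolding a by (simp only: cos_add cos_diff) simp
    qed
    then show ?thesis unfolding p(2) q(2) by simp
  qed
  then show ?case using d by blast
qed

text \<open>The condition on \<open>l\<close> keeps the slice inside \<open>[0, n * pi]\<close>,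
  half a period, where \<open>y\<close> is determined by \<open>cos (y / n)\<close>. Distinct zeros
  therefore give distinct roots of a non-zero polynomial of degree at most \<open>n\<close>.\<close>

lemma cos_sum_deriv_card_zeros:
  assumes n: "n \<ge> 1" and l: "l \<le> n - 1" and nz: "cos_sum_deriv b n 0 y0 \<noteq> 0"
    and Y: "finite Y" "Y \<subseteq> {real l * pi..(real l + 1) * pi}" "\<And>y. y \<in> Y \<Longrightarrow> cos_sum_deriv b n 0 y = 0"
  shows "card Y \<le> n"
proof -
  obtain p :: "nat \<Rightarrow> real poly" where p: "\<And>j. degree (p j) \<le> j" "\<And>j t. cos (real j * t) = poly (p j) (cos t)"
    using cos_multiple_poly by metis
  define P where "P = (\<Sum>j = 1..n. smult (b j) (p j))"
  have derivP: "cos_sum_deriv b n 0 y = poly P (cos (y / real n))" for y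
  proof -
    have "cos_sum_deriv b n 0 y = (\<Sum>j = 1..n. b j * cos (real j * (y / real n)))" by (simp add: cos_sum_deriv_def)
    then show ?thesis unfolding p(2) P_def by (simp add: poly_sum)
  qed
  have dP: "degree P \<le> n" unfolding P_def
    by (intro degree_sum_le) (auto intro: order_trans[OF degree_smult_le] order_trans[OF p(1)])
  have P0: "P \<noteq> 0" using nz derivP by auto
  have ran: "y / real n \<in> {0..pi}" if "y \<in> Y" for y
  proof -
    have "y \<ge> real l * pi" "y \<le> (real l + 1) * pi" using Y(2) that by auto
    moreover have "(real l + 1) * pi \<le> real n * pi" using l n by (intro mult_right_mono) auto
    moreover have "0 \<le> real l * pi" by simp
    ultimately have "0 \<le> y" "y \<le> real n * pi" by linarith+
    then show ?thesis using n by (simp add: pos_divide_le_eq mult.commute)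
  qed
  have "inj_on (\<lambda>y. cos (y / real n)) Y"
  proof (rule inj_onI)
    fix y z assume "y \<in> Y" "z \<in> Y" "cos (y / real n) = cos (z / real n)"
    then have "y / real n = z / real n" using ran cos_inj_pi[of "y / real n" "z / real n"] by auto
    then show "y = z" using n by simp
  qed
  then have "card Y = card ((\<lambda>y. cos (y / real n)) ` Y)" by (rule card_image[symmetric])
  also have "\<dots> \<le> card {x. poly P x = 0}"
    using Y(3) derivP P0 by (intro card_mono poly_roots_finite) auto
  also have "\<dots> \<le> degree P" using P0 by (rule card_poly_roots_bound)
  finally show ?thesis using dP by simp
qed

text \<open>Interpolation asks for the m-th derivative on the whole slice, while the hypothesis
  controls derivatives at the left endpoint only. Taylor expansion at \<open>c\<close> bridges this:
  the terms \<open>2 ^ (m + (m + k)) * pi ^ k / fact k\<close> add up to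
  \<open>4 ^ m * exp (2 * pi)\<close>.\<close>

lemma cos_sum_deriv_abs_le_of_zeros:
  assumes Y: "finite Y" "card Y = m" "Y \<subseteq> {c..c + pi}" "\<And>y. y \<in> Y \<Longrightarrow> cos_sum_deriv b n 0 y = 0"
    and b: "\<And>k. \<bar>cos_sum_deriv b n k c\<bar> \<le> 2 ^ (m + k)" and y: "y \<in> {c..c + pi}"
  shows "\<bar>cos_sum_deriv b n 0 y\<bar> \<le> exp (2 * pi) * (4 * pi) ^ m / fact m"
proof -
  have B: "\<bar>cos_sum_deriv b n m t\<bar> \<le> 4 ^ m * exp (2 * pi)" if t: "t \<in> {c..c + pi}" for t
  proof -
    have 1: "(\<lambda>k. cos_sum_deriv b n (m + k) c * (t - c) ^ k / fact k) sums cos_sum_deriv b n m (c + (t - c))"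
      by (rule cos_sum_deriv_taylor)
    have 2: "(\<lambda>k. 4 ^ m * ((2 * pi) ^ k /\<^sub>R fact k)) sums (4 ^ m * exp (2 * pi))"
      by (intro sums_mult exp_converges)
    have "norm (cos_sum_deriv b n (m + k) c * (t - c) ^ k / fact k) \<le> 4 ^ m * ((2 * pi) ^ k /\<^sub>R fact k)" for k
    proof -
      have "\<bar>cos_sum_deriv b n (m + k) c\<bar> * \<bar>t - c\<bar> ^ k \<le> 2 ^ (m + (m + k)) * pi ^ k"
        using b[of "m + k"] t by (intro mult_mono power_mono) auto
      also have "\<dots> = 4 ^ m * (2 * pi) ^ k"
      proof -
        have "(2::real) ^ (m + (m + k)) = (2 * 2) ^ m * 2 ^ k" by (simp only: power_add power_mult_distrib mult.assoc)
        then show ?thesis by (simp add: power_mult_distrib)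
      qed
      finally have "\<bar>cos_sum_deriv b n (m + k) c\<bar> * \<bar>t - c\<bar> ^ k / fact k \<le> 4 ^ m * (2 * pi) ^ k / fact k"
        by (rule divide_right_mono) simp
      then show ?thesis
        by (simp add: abs_mult power_abs scaleR_conv_of_real divide_inverse mult_ac)
    qed
    from norm_sums_le[OF 1 2 this] show ?thesis by simp
  qed
  have "\<bar>cos_sum_deriv b n 0 y\<bar> \<le> 4 ^ m * exp (2 * pi) * ((c + pi) - c) ^ m / fact m"
    by (rule abs_le_of_zeros[OF cos_sum_deriv_deriv Y B y])
  then show ?thesis by (simp add: power_mult_distrib mult_ac)
qed

section \<open>Trigonometric sums\<close>

text \<open>Here \<open>t\<close> is arbitrary, so no exact evaluation is available. Instead
  \<open>i\<close> is paired with \<open>2 * i\<close>: the squared cosines of an angle and of its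
  double add up to at least 7/16. There are at least \<open>n / 3\<close> such pairs and each index
  is used at most twice, whence 7/96.\<close>

lemma sum_cos_sq_lower:
  assumes n: "n \<ge> 2"
  shows "7 / 96 * real n \<le> (\<Sum>i = 1..n. (cos (real i * t))\<^sup>2)"
proof -
  define h where "h = n div 2"
  have "n \<le> 3 * h" using n unfolding h_def by presburger
  then have h: "real n / 3 \<le> real h" by linarith
  let ?S = "\<Sum>i = 1..n. (cos (real i * t))\<^sup>2"
  have pt: "7 / 16 \<le> (cos s)\<^sup>2 + (cos (2 * s))\<^sup>2" for s :: real
  proof -
    have "(cos s)\<^sup>2 + (cos (2 * s))\<^sup>2 - 7/16 = (2 * (cos s)\<^sup>2 - 3/4)\<^sup>2"
      unfolding cos_double_cos by (simp add: power2_eq_square algebra_simps)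
    then show ?thesis using zero_le_power2[of "2 * (cos s)\<^sup>2 - 3/4"] by linarith
  qed
  have 1: "(\<Sum>i = 1..h. (cos (real i * t))\<^sup>2) \<le> ?S"
    unfolding h_def by (intro sum_mono2) auto
  have 2: "(\<Sum>i = 1..h. (cos (2 * (real i * t)))\<^sup>2) \<le> ?S"
  proof -
    have "(\<Sum>i = 1..h. (cos (2 * (real i * t)))\<^sup>2) = (\<Sum>i\<in>(\<lambda>i. 2 * i) ` {1..h}. (cos (real i * t))\<^sup>2)"
      by (subst sum.reindex) (auto simp: inj_on_def mult.assoc)
    also have "\<dots> \<le> ?S" unfolding h_def by (intro sum_mono2) auto
    finally show ?thesis .
  qed
  have "real h * (7/16) = (\<Sum>i = 1..h. 7/16)" by simp
  also have "\<dots> \<le> (\<Sum>i = 1..h. (cos (real i * t))\<^sup>2 + (cos (2 * (real i * t)))\<^sup>2)"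
    by (intro sum_mono pt)
  also have "\<dots> \<le> 2 * ?S" using 1 2 by (simp add: sum.distrib)
  finally show ?thesis using h by linarith
qed

section \<open>Cosine sums at multiples of \<open>pi / n\<close>\<close>

lemma sum_cos_telescope:
  "2 * sin (\<theta> / 2) * (\<Sum>j = 1..n. cos (real j * \<theta>)) = sin (real n * \<theta> + \<theta> / 2) - sin (\<theta> / 2)"
proof (induction n)
  case (Suc n)
  have "2 * sin (\<theta> / 2) * cos (real (Suc n) * \<theta>) = sin (real (Suc n) * \<theta> + \<theta> / 2) - sin (real n * \<theta> + \<theta> / 2)"
  proof -
    have "real n * \<theta> + \<theta> / 2 = real (Suc n) * \<theta> - \<theta> / 2" by (simp add: field_simps)
    then show ?thesis by (simp only: sin_add sin_diff) (simp add: algebra_simps)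
  qed
  then show ?case using Suc by (simp add: distrib_left)
qed simp

text \<open>On the grid the Dirichlet kernel degenerates to \<open>((-1) ^ k - 1) / 2\<close>; the
  range of \<open>k\<close> ensures that the sine divided by is positive. The endpoints of the
  slices lie on this grid.\<close>

lemma sum_cos_multiples:
  assumes k: "0 < k" "k < 2 * n"
  shows "(\<Sum>j = 1..n. cos (real j * (real k * pi / real n))) = (if odd k then - 1 else 0)"
proof -
  let ?\<theta> = "real k * pi / real n"
  have n: "n > 0" using k by auto
  have "0 < ?\<theta> / 2" "?\<theta> / 2 < pi" using k n by (auto simp: field_simps)
  then have s: "sin (?\<theta> / 2) > 0" by (rule sin_gt_zero)
  have "real n * ?\<theta> = real k * pi" using n by simp
  then have "sin (real n * ?\<theta> + ?\<theta> / 2) = (-1) ^ k * sin (?\<theta> / 2)"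
    by (simp only: sin_add) (simp add: mult.commute)
  then have "2 * sin (?\<theta> / 2) * (\<Sum>j = 1..n. cos (real j * ?\<theta>)) = ((-1) ^ k - 1) * sin (?\<theta> / 2)"
    unfolding sum_cos_telescope by (simp add: algebra_simps)
  then have "2 * (\<Sum>j = 1..n. cos (real j * ?\<theta>)) = (-1) ^ k - 1" using s by simp
  then show ?thesis by (cases "odd k") auto
qed

lemma sum_cos_sq_grid:
  assumes "n \<ge> 1" "l \<le> n"
  shows "real n / 2 \<le> (\<Sum>j = 1..n. (cos (real j * (real l * pi) / real n))\<^sup>2)"
proof -
  have "(\<Sum>j = 1..n. (cos (real j * (real l * pi) / real n))\<^sup>2)
      = (\<Sum>j = 1..n. 1 / 2 + cos (real j * (real (2 * l) * pi / real n)) / 2)"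
  proof (intro sum.cong refl)
    fix j
    have "real j * (real (2 * l) * pi / real n) = 2 * (real j * (real l * pi) / real n)" by simp
    then show "(cos (real j * (real l * pi) / real n))\<^sup>2 = 1 / 2 + cos (real j * (real (2 * l) * pi / real n)) / 2"
      by (simp only: cos_double_cos) (simp add: field_simps)
  qed
  also have "\<dots> = real n / 2 + (\<Sum>j = 1..n. cos (real j * (real (2 * l) * pi / real n))) / 2"
    by (simp only: sum.distrib sum_divide_distrib[symmetric]) simp
  finally have eq: "(\<Sum>j = 1..n. (cos (real j * (real l * pi) / real n))\<^sup>2) =
     real n / 2 + (\<Sum>j = 1..n. cos (real j * (real (2 * l) * pi / real n))) / 2" .
  have "0 \<le> (\<Sum>j = 1..n. cos (real j * (real (2 * l) * pi / real n)))"
  proof -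
    \<comment> \<open>The boundary cases are those where \<open>2 * l\<close> leaves the range of
      \<open>sum_cos_multiples\<close>; all cosines equal 1 there.\<close>
    consider "l = 0" | "l = n" | "0 < l" "l < n" using assms by linarith
    then show ?thesis
    proof cases
      case 1 then show ?thesis by simp
    next
      case 2
      have "cos (real j * (real (2 * l) * pi / real n)) = 1" for j
        using cos_int_2pin[of "int j"] assms 2 by (simp add: mult_ac)
      then show ?thesis by simp
    next
      case 3
      then show ?thesis using sum_cos_multiples[of "2 * l" n] by simp
    qed
  qed
  then show ?thesis using eq by simp
qed

text \<open>At the two endpoints of a side of a square the cosine vectors have inner product exactly
  \<open>- 1\<close>, so their Gram matrix is at least \<open>n / 2 - 1\<close> times the identity.\<close>

lemma gram_lower:
  assumes n: "n \<ge> 3" and l: "l < n"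
  shows "7 / 576 * (real n)\<^sup>2 * (s\<^sup>2 + t\<^sup>2) \<le> (\<Sum>i = 1..n. \<Sum>j = 1..n.
    (s * (cos (real i * x / real n) * cos (real j * (real l * pi) / real n)) +
     t * (cos (real i * x / real n) * cos (real j * (real (Suc l) * pi) / real n)))\<^sup>2)"
proof -
  let ?a = "\<lambda>j::nat. cos (real j * (real l * pi) / real n)"
  let ?b = "\<lambda>j::nat. cos (real j * (real (Suc l) * pi) / real n)"
  let ?c = "\<lambda>i::nat. cos (real i * x / real n)"
  \<comment> \<open>The product formula gives the frequencies 1 and \<open>2 * l + 1\<close>. Both
    are odd, so each sum is -1 and each enters with the factor 1/2.\<close>
  have X: "(\<Sum>j = 1..n. ?a j * ?b j) = - 1"
  proof -
    have "?a j * ?b j = cos (real j * (real 1 * pi / real n)) / 2 + cos (real j * (real (2 * l + 1) * pi / real n)) / 2" for j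
    proof -
      have e: "real j * (real 1 * pi / real n) = real j * (real (Suc l) * pi) / real n - real j * (real l * pi) / real n"
        "real j * (real (2 * l + 1) * pi / real n) = real j * (real (Suc l) * pi) / real n + real j * (real l * pi) / real n"
        by (simp_all add: diff_divide_distrib[symmetric] add_divide_distrib[symmetric] algebra_simps)
      show ?thesis unfolding e cos_add cos_diff by (simp add: field_simps)
    qed
    then have "(\<Sum>j = 1..n. ?a j * ?b j) = (\<Sum>j = 1..n. cos (real j * (real 1 * pi / real n))) / 2 +
        (\<Sum>j = 1..n. cos (real j * (real (2 * l + 1) * pi / real n))) / 2"
      by (simp only: sum.distrib sum_divide_distrib)
    also have "\<dots> = - 1"
      using sum_cos_multiples[of 1 n] sum_cos_multiples[of "2 * l + 1" n] n l by simp
    finally show ?thesis .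
  qed
  have "(\<Sum>j = 1..n. (s * ?a j + t * ?b j)\<^sup>2) =
      (\<Sum>j = 1..n. s\<^sup>2 * (?a j)\<^sup>2 + t\<^sup>2 * (?b j)\<^sup>2 + 2 * s * t * (?a j * ?b j))"
    by (intro sum.cong refl) (simp add: power2_eq_square algebra_simps)
  also have "\<dots> = s\<^sup>2 * (\<Sum>j = 1..n. (?a j)\<^sup>2) + t\<^sup>2 * (\<Sum>j = 1..n. (?b j)\<^sup>2) + 2 * s * t * (\<Sum>j = 1..n. ?a j * ?b j)"
    by (simp only: sum.distrib sum_distrib_left)
  also have "\<dots> \<ge> s\<^sup>2 * (real n / 2) + t\<^sup>2 * (real n / 2) - (s\<^sup>2 + t\<^sup>2)"
  proof -
    have "2 * s * t \<le> s\<^sup>2 + t\<^sup>2" using zero_le_power2[of "s - t"] by (simp add: power2_eq_square algebra_simps)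
    moreover have "s\<^sup>2 * (real n / 2) \<le> s\<^sup>2 * (\<Sum>j = 1..n. (?a j)\<^sup>2)"
      using n l by (intro mult_left_mono sum_cos_sq_grid) auto
    moreover have "t\<^sup>2 * (real n / 2) \<le> t\<^sup>2 * (\<Sum>j = 1..n. (?b j)\<^sup>2)"
      using n l by (intro mult_left_mono sum_cos_sq_grid) auto
    ultimately show ?thesis unfolding X by linarith
  qed
  also have "s\<^sup>2 * (real n / 2) + t\<^sup>2 * (real n / 2) - (s\<^sup>2 + t\<^sup>2) = (real n / 2 - 1) * (s\<^sup>2 + t\<^sup>2)"
    by (simp add: algebra_simps)
  finally have Q: "(real n / 2 - 1) * (s\<^sup>2 + t\<^sup>2) \<le> (\<Sum>j = 1..n. (s * ?a j + t * ?b j)\<^sup>2)" .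
  \<comment> \<open>\<open>n / 2 - 1\<close> is at least \<open>n / 6\<close> exactly from
    \<open>n = 3\<close> on; 7/576 is the product of 7/96 and 1/6.\<close>
  have "real n / 6 * (s\<^sup>2 + t\<^sup>2) \<le> (real n / 2 - 1) * (s\<^sup>2 + t\<^sup>2)"
    using n by (intro mult_right_mono) auto
  then have Q': "real n / 6 * (s\<^sup>2 + t\<^sup>2) \<le> (\<Sum>j = 1..n. (s * ?a j + t * ?b j)\<^sup>2)" using Q by linarith
  have P: "7 / 96 * real n \<le> (\<Sum>i = 1..n. (?c i)\<^sup>2)"
    using sum_cos_sq_lower[of n "x / real n"] n by simp
  have "7 / 576 * (real n)\<^sup>2 * (s\<^sup>2 + t\<^sup>2) = (7 / 96 * real n) * (real n / 6 * (s\<^sup>2 + t\<^sup>2))"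
    by (simp add: power2_eq_square)
  also have "\<dots> \<le> (\<Sum>i = 1..n. (?c i)\<^sup>2) * (\<Sum>j = 1..n. (s * ?a j + t * ?b j)\<^sup>2)"
    using P Q' by (intro mult_mono sum_nonneg) auto
  also have "\<dots> = (\<Sum>i = 1..n. \<Sum>j = 1..n. (?c i)\<^sup>2 * (s * ?a j + t * ?b j)\<^sup>2)"
    by (rule sum_product)
  also have "\<dots> = (\<Sum>i = 1..n. \<Sum>j = 1..n. (s * (?c i * ?a j) + t * (?c i * ?b j))\<^sup>2)"
    by (intro sum.cong refl) (simp add: power_mult_distrib[symmetric] algebra_simps)
  finally show ?thesis .
qed

section \<open>The Fejer kernel and Gaussian sums\<close>

definition fejer :: "nat \<Rightarrow> real \<Rightarrow> real" where
  "fejer N x = (1 / (real N)\<^sup>2) * (\<Sum>j<N. \<Sum>k<N. cos ((real j - real k) / real N * x))"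

text \<open>The kernel is the squared modulus of the mean of \<open>N\<close> exponentials with
  frequencies \<open>k / N\<close>, hence nonnegative. Its own frequencies stay below 1 in modulus,
  which keeps the arguments of characteristic functions small.\<close>

lemma fejer_eq: "fejer N x =
  (1 / (real N)\<^sup>2) * ((\<Sum>k<N. cos (real k / real N * x))\<^sup>2 + (\<Sum>k<N. sin (real k / real N * x))\<^sup>2)"
proof -
  have "(\<Sum>j<N. \<Sum>k<N. cos ((real j - real k) / real N * x)) =
     (\<Sum>j<N. \<Sum>k<N. cos (real j / real N * x) * cos (real k / real N * x) + sin (real j / real N * x) * sin (real k / real N * x))"
    by (intro sum.cong refl) (simp only: diff_divide_distrib left_diff_distrib cos_diff)
  then show ?thesis unfolding fejer_def
    by (simp only: power2_eq_square sum_product sum.distrib)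
qed

lemma fejer_nonneg: "0 \<le> fejer N x"
  unfolding fejer_eq by simp

text \<open>All phases are at most 1, which is below \<open>pi / 3\<close>, so every cosine is at
  least 1/2.\<close>

lemma fejer_ge:
  assumes N: "N > 0" and x: "\<bar>x\<bar> \<le> 1"
  shows "1 / 4 \<le> fejer N x"
proof -
  have c: "1 / 2 \<le> cos (real k / real N * x)" if "k < N" for k
  proof -
    have "\<bar>real k / real N * x\<bar> \<le> 1 * 1" unfolding abs_mult using that x by (intro mult_mono) auto
    then have a: "\<bar>real k / real N * x\<bar> \<le> pi / 3" using pi_gt3 by linarith
    have "cos (pi / 3) \<le> cos \<bar>real k / real N * x\<bar>"
      by (rule cos_monotone_0_pi_le[OF _ a]) auto
    then show ?thesis by (simp only: cos_abs_real cos_60)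
  qed
  have "real N * (1 / 2) \<le> (\<Sum>k<N. cos (real k / real N * x))"
    using sum_mono[of "{..<N}" "\<lambda>_. 1/2" "\<lambda>k. cos (real k / real N * x)"] c by simp
  then have "(real N * (1 / 2))\<^sup>2 \<le> (\<Sum>k<N. cos (real k / real N * x))\<^sup>2"
    by (rule power_mono) simp
  then have "(real N * (1 / 2))\<^sup>2 \<le> (\<Sum>k<N. cos (real k / real N * x))\<^sup>2 + (\<Sum>k<N. sin (real k / real N * x))\<^sup>2"
    by (simp add: add_increasing2)
  then have "(1 / (real N)\<^sup>2) * (real N * (1 / 2))\<^sup>2 \<le> fejer N x"
    unfolding fejer_eq by (intro mult_left_mono) auto
  then show ?thesis using N by (simp add: power_mult_distrib power_divide)
qed

text \<open>The inequality \<open>- y^2 \<le> 1/4 - y\<close> replaces the Gaussian by a two-sided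
  geometric series with ratio \<open>exp (- 1 / \<tau>)\<close>. For \<open>\<tau> \<ge> 1\<close>
  each side sums to at most \<open>exp 1 * \<tau>\<close>, so the total is at most
  \<open>2 * exp (5/4) * \<tau>\<close>.\<close>

lemma gaussian_sum_le:
  assumes \<tau>: "\<tau> \<ge> 1"
  shows "(\<Sum>k<N. exp (- ((real j - real k) / \<tau>)\<^sup>2)) \<le> 8 * \<tau>"
proof -
  define r where "r = exp (- (1 / \<tau>))"
  have r: "0 < r" "r < 1" using \<tau> by (auto simp: r_def)
  have geo: "(\<Sum>i<m. r ^ i) \<le> exp 1 * \<tau>" for m
  proof -
    have "1 / \<tau> \<le> exp (1 / \<tau>) - 1" using exp_ge_add_one_self[of "1 / \<tau>"] by linarith
    then have "1 / \<tau> * r \<le> (exp (1 / \<tau>) - 1) * r" using r by (intro mult_right_mono) auto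
    also have "\<dots> = 1 - r" by (simp add: r_def left_diff_distrib flip: exp_add)
    finally have a: "r / \<tau> \<le> 1 - r" by simp
    have "exp (- 1) \<le> r" using \<tau> by (simp add: r_def)
    then have "exp (- 1) / \<tau> \<le> r / \<tau>" using \<tau> by (intro divide_right_mono) auto
    then have b: "exp (- 1) / \<tau> \<le> 1 - r" using a by linarith
    have "(\<Sum>i<m. r ^ i) = (1 - r ^ m) / (1 - r)" using r by (simp add: sum_gp_strict)
    also have "\<dots> \<le> 1 / (1 - r)" using r by (intro divide_right_mono) auto
    also have "\<dots> \<le> 1 / (exp (- 1) / \<tau>)" using b \<tau> r by (intro divide_left_mono) auto
    also have "\<dots> = exp 1 * \<tau>" by (simp add: exp_minus divide_inverse mult.commute)
    finally show ?thesis .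
  qed
  have pt: "exp (- ((real j - real k) / \<tau>)\<^sup>2) \<le> exp (1/4) * (if k \<le> j then r ^ (j - k) else r ^ (k - j))" for k
  proof -
    define y where "y = \<bar>real j - real k\<bar> / \<tau>"
    have "- ((real j - real k) / \<tau>)\<^sup>2 = - y\<^sup>2" by (simp add: y_def power_divide)
    also have "\<dots> \<le> 1/4 - y" using zero_le_power2[of "y - 1/2"] by (simp add: power2_eq_square algebra_simps)
    finally have "exp (- ((real j - real k) / \<tau>)\<^sup>2) \<le> exp (1/4) * exp (- y)"
      by (simp flip: exp_add)
    also have "exp (- y) = (if k \<le> j then r ^ (j - k) else r ^ (k - j))"
      by (simp add: y_def r_def exp_of_nat_mult[symmetric] of_nat_diff)
    finally show ?thesis .
  qed
  have "(\<Sum>k<N. if k \<le> j then r ^ (j - k) else r ^ (k - j)) \<le> (\<Sum>k\<in>{..j} \<union> {j..<j + N}. if k \<le> j then r ^ (j - k) else r ^ (k - j))"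
    using r by (intro sum_mono2) auto
  also have "\<dots> \<le> (\<Sum>k\<in>{..j}. if k \<le> j then r ^ (j - k) else r ^ (k - j)) + (\<Sum>k\<in>{j..<j + N}. if k \<le> j then r ^ (j - k) else r ^ (k - j))"
    using r by (subst sum_Un) (auto intro!: sum_nonneg)
  also have "(\<Sum>k\<in>{..j}. if k \<le> j then r ^ (j - k) else r ^ (k - j)) = (\<Sum>i<Suc j. r ^ i)"
    by (rule sum.reindex_bij_witness[of _ "\<lambda>i. j - i" "\<lambda>k. j - k"]) auto
  also have "(\<Sum>k\<in>{j..<j + N}. if k \<le> j then r ^ (j - k) else r ^ (k - j)) = (\<Sum>i<N. r ^ i)"
    by (rule sum.reindex_bij_witness[of _ "\<lambda>i. j + i" "\<lambda>k. k - j"]) auto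
  also have "(\<Sum>i<Suc j. r ^ i) + (\<Sum>i<N. r ^ i) \<le> 2 * (exp 1 * \<tau>)"
    using geo[of "Suc j"] geo[of N] by linarith
  finally have S: "(\<Sum>k<N. if k \<le> j then r ^ (j - k) else r ^ (k - j)) \<le> 2 * (exp 1 * \<tau>)" .
  have "(\<Sum>k<N. exp (- ((real j - real k) / \<tau>)\<^sup>2)) \<le> (\<Sum>k<N. exp (1/4) * (if k \<le> j then r ^ (j - k) else r ^ (k - j)))"
    by (intro sum_mono pt)
  also have "\<dots> = exp (1/4) * (\<Sum>k<N. if k \<le> j then r ^ (j - k) else r ^ (k - j))"
    by (rule sum_distrib_left[symmetric])
  also have "\<dots> \<le> exp (1/4) * (2 * (exp 1 * \<tau>))" by (intro mult_left_mono S) simp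
  also have "\<dots> = 2 * exp (5/4) * \<tau>" by (simp flip: exp_add)
  also have "\<dots> \<le> 8 * \<tau>"
  proof -
    \<comment> \<open>The fifth power of 21/16 is just below 4, which gives
      \<open>exp (5/4) \<le> 4\<close>.\<close>
    have "exp (1/4 :: real) \<le> 1 + 1/4 + (1/4)\<^sup>2" by (rule exp_bound) auto
    then have "exp (1/4 :: real) ^ 5 \<le> (1 + 1/4 + (1/4)\<^sup>2) ^ 5" by (rule power_mono) simp
    also have "\<dots> \<le> (4::real)" by (simp add: power2_eq_square eval_nat_numeral)
    also have "exp (1/4 :: real) ^ 5 = exp (5/4)" by (simp flip: exp_of_nat_mult)
    finally show ?thesis using \<tau> by (intro mult_right_mono) auto
  qed
  finally show ?thesis .
qed

section \<open>Anticoncentration\<close>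

lemma double_sum_product:
  fixes f g :: "'i \<Rightarrow> 'j \<Rightarrow> real"
  shows "(\<Sum>j\<in>A. \<Sum>k\<in>B. f j k) * (\<Sum>j\<in>A. \<Sum>k\<in>B. g j k) =
    (\<Sum>j\<in>A. \<Sum>k\<in>B. \<Sum>j'\<in>A. \<Sum>k'\<in>B. f j k * g j' k')"
proof -
  define T where "T = (\<Sum>j\<in>A. \<Sum>k\<in>B. g j k)"
  have "(\<Sum>j\<in>A. \<Sum>k\<in>B. f j k) * T = (\<Sum>j\<in>A. \<Sum>k\<in>B. f j k * T)"
    by (simp only: sum_distrib_right)
  then show ?thesis unfolding T_def by (simp only: sum_distrib_left)
qed

context prob_space
begin

text \<open>Only second moments are finite, so the Taylor error of the characteristic function is
  made small by dominated convergence instead of a third moment. The threshold 3/2 makes the error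
  at most \<open>t^2 / 4\<close>, half of the quadratic term. The radius \<open>s0\<close> depends
  on the law of \<open>X\<close> alone.\<close>

lemma char_le_gaussian:
  fixes X :: "'a \<Rightarrow> real"
  assumes X[measurable]: "random_variable borel X"
    and m: "expectation X = 0" "expectation (\<lambda>\<omega>. (X \<omega>)\<^sup>2) = 1"
  obtains s0 where "s0 > 0" "\<And>t. \<bar>t\<bar> \<le> s0 \<Longrightarrow> cmod (char (distr M borel X) t) \<le> exp (- t\<^sup>2 / 4)"
proof -
  \<comment> \<open>A non-integrable function has Bochner integral 0, so the value 1 forces
    integrability.\<close>
  have int2: "integrable M (\<lambda>\<omega>. (X \<omega>)\<^sup>2)"
    by (rule ccontr) (use m(2) not_integrable_integral_eq in force)
  have int1: "integrable M X" by (rule square_integrable_imp_integrable[OF X int2])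
  have var: "variance X = 1" using m by simp
  define I where "I k = expectation (\<lambda>\<omega>. min (6 * (X \<omega>)\<^sup>2) (1 / real (Suc k) * \<bar>X \<omega>\<bar> ^ 3))" for k
  have lim: "(\<lambda>k. min (6 * (X \<omega>)\<^sup>2) (1 / real (Suc k) * \<bar>X \<omega>\<bar> ^ 3)) \<longlonglongrightarrow> 0" for \<omega>
  proof -
    have "(\<lambda>k. min (6 * (X \<omega>)\<^sup>2) (1 / real (Suc k) * \<bar>X \<omega>\<bar> ^ 3)) \<longlonglongrightarrow> min (6 * (X \<omega>)\<^sup>2) (0 * \<bar>X \<omega>\<bar> ^ 3)"
      by (intro tendsto_min tendsto_const tendsto_mult LIMSEQ_Suc lim_1_over_n)
    then show ?thesis by simp
  qed
  have "I \<longlonglongrightarrow> expectation (\<lambda>\<omega>. 0)"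
    unfolding I_def
    by (rule integral_dominated_convergence[where w="\<lambda>\<omega>. 6 * (X \<omega>)\<^sup>2"]) (use int2 lim in auto)
  then have "I \<longlonglongrightarrow> 0" by simp
  then have "\<forall>\<^sub>F k in sequentially. I k < 3/2" by (rule order_tendstoD) simp
  then obtain k where k: "I k < 3/2" by (meson eventually_sequentially order_refl)
  show ?thesis
  proof (rule that[of "1 / real (Suc k)"])
    show "1 / real (Suc k) > 0" by simp
    fix t :: real assume t: "\<bar>t\<bar> \<le> 1 / real (Suc k)"
    have "1 / real (Suc k) \<le> 1" by simp
    then have t1: "\<bar>t\<bar> \<le> 1" using t by linarith
    have "expectation (\<lambda>\<omega>. min (6 * (X \<omega>)\<^sup>2) (\<bar>t\<bar> * \<bar>X \<omega>\<bar> ^ 3)) \<le> I k"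
      unfolding I_def
    proof (rule integral_mono)
      show "integrable M (\<lambda>\<omega>. min (6 * (X \<omega>)\<^sup>2) (\<bar>t\<bar> * \<bar>X \<omega>\<bar> ^ 3))"
        by (rule Bochner_Integration.integrable_bound[where f="\<lambda>\<omega>. 6 * (X \<omega>)\<^sup>2"]) (use int2 in auto)
      show "integrable M (\<lambda>\<omega>. min (6 * (X \<omega>)\<^sup>2) (1 / real (Suc k) * \<bar>X \<omega>\<bar> ^ 3))"
        by (rule Bochner_Integration.integrable_bound[where f="\<lambda>\<omega>. 6 * (X \<omega>)\<^sup>2"]) (use int2 in auto)
      show "min (6 * (X \<omega>)\<^sup>2) (\<bar>t\<bar> * \<bar>X \<omega>\<bar> ^ 3) \<le> min (6 * (X \<omega>)\<^sup>2) (1 / real (Suc k) * \<bar>X \<omega>\<bar> ^ 3)" for \<omega>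
        by (intro min.mono order_refl mult_right_mono t) simp
    qed
    then have "t\<^sup>2 / 6 * expectation (\<lambda>\<omega>. min (6 * (X \<omega>)\<^sup>2) (\<bar>t\<bar> * \<bar>X \<omega>\<bar> ^ 3)) \<le> t\<^sup>2 / 6 * (3/2)"
      using k by (intro mult_left_mono) auto
    then have "cmod (char (distr M borel X) t - (1 - t\<^sup>2 * 1 / 2)) \<le> t\<^sup>2 / 6 * (3/2)"
      using char_approx3'[OF X int1 int2 m(1) var refl, of t] by linarith
    moreover have "cmod (char (distr M borel X) t) \<le>
        cmod (char (distr M borel X) t - (1 - t\<^sup>2 * 1 / 2)) + cmod (1 - t\<^sup>2 * 1 / 2)"
      by (metis diff_add_cancel norm_triangle_ineq)
    moreover have "cmod (1 - t\<^sup>2 * 1 / 2) = 1 - t\<^sup>2 / 2"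
    proof -
      have "t\<^sup>2 \<le> 1" using t1 by (simp add: abs_square_le_1)
      moreover have "1 - (complex_of_real t)\<^sup>2 * 1 / 2 = complex_of_real (1 - t\<^sup>2 / 2)" by simp
      ultimately show ?thesis by (simp only: norm_of_real)
    qed
    ultimately have "cmod (char (distr M borel X) t) \<le> 1 - t\<^sup>2 / 4" by simp
    also have "\<dots> \<le> exp (- t\<^sup>2 / 4)" using exp_ge_add_one_self[of "- t\<^sup>2 / 4"] by simp
    finally show "cmod (char (distr M borel X) t) \<le> exp (- t\<^sup>2 / 4)" .
  qed
qed

text \<open>The expectation is the real part of a characteristic function, whose modulus factorises
  by independence. The bound on \<open>w\<close> keeps each factor where the Gaussian estimate
  holds.\<close>

lemma expectation_cos_sum_le:
  fixes X :: "'i \<Rightarrow> 'a \<Rightarrow> real"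
  assumes A: "finite A" and indep: "indep_vars (\<lambda>_. borel) X A"
    and char: "\<And>i t. i \<in> A \<Longrightarrow> \<bar>t\<bar> \<le> s0 \<Longrightarrow> cmod (char (distr M borel (X i)) t) \<le> exp (- t\<^sup>2 / 4)"
    and w: "\<And>i. i \<in> A \<Longrightarrow> \<bar>w i\<bar> \<le> s0"
  shows "expectation (\<lambda>\<omega>. cos (\<Sum>i\<in>A. w i * X i \<omega>)) \<le> exp (- (\<Sum>i\<in>A. (w i)\<^sup>2) / 4)"
proof -
  have rv[measurable]: "random_variable borel (X i)" if "i \<in> A" for i
    using indep that by (simp add: indep_vars_def)
  let ?Y = "\<lambda>\<omega>. \<Sum>i\<in>A. w i * X i \<omega>"
  have Y[measurable]: "random_variable borel ?Y" by measurable
  have int: "integrable M (\<lambda>\<omega>. iexp (?Y \<omega>))"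
    by (intro integrable_const_bound[where B=1]) auto
  have "char (distr M borel ?Y) 1 = (CLINT \<omega>|M. iexp (?Y \<omega>))"
    by (simp add: char_def integral_distr)
  then have "expectation (\<lambda>\<omega>. cos (?Y \<omega>)) = Re (char (distr M borel ?Y) 1)"
    using integral_Re[OF int] by (simp add: Re_exp)
  also have "\<dots> \<le> cmod (char (distr M borel ?Y) 1)" by (rule complex_Re_le_cmod)
  also have "char (distr M borel ?Y) 1 = (\<Prod>i\<in>A. char (distr M borel (\<lambda>\<omega>. w i * X i \<omega>)) 1)"
    by (rule char_distr_sum, rule indep_vars_compose2[OF indep]) simp
  also have "\<dots> = (\<Prod>i\<in>A. char (distr M borel (X i)) (w i))"
    by (intro prod.cong refl) (simp add: char_def integral_distr)
  also have "cmod \<dots> = (\<Prod>i\<in>A. cmod (char (distr M borel (X i)) (w i)))" by (rule prod_norm[symmetric])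
  also have "\<dots> \<le> (\<Prod>i\<in>A. exp (- (w i)\<^sup>2 / 4))"
    by (intro prod_mono conjI char w) auto
  also have "\<dots> = exp (- (\<Sum>i\<in>A. (w i)\<^sup>2) / 4)"
    using A by (simp add: exp_sum[symmetric] sum_divide_distrib[symmetric] sum_negf)
  finally show ?thesis .
qed

text \<open>Esseen's argument: the Fejer kernel is at least \<open>1 / 4\<close> on \<open>[-1, 1]\<close>, and it is a finite
  combination of cosines, whose expectations are controlled by the characteristic functions.\<close>

lemma small_ball_pair:
  fixes X :: "'i \<Rightarrow> 'a \<Rightarrow> real" and u v :: "'i \<Rightarrow> real"
  assumes A: "finite A" and indep: "indep_vars (\<lambda>_. borel) X A"
    and char: "\<And>i t. i \<in> A \<Longrightarrow> \<bar>t\<bar> \<le> s0 \<Longrightarrow> cmod (char (distr M borel (X i)) t) \<le> exp (- t\<^sup>2 / 4)"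
    and uv: "\<And>i. i \<in> A \<Longrightarrow> \<bar>u i\<bar> \<le> 1" "\<And>i. i \<in> A \<Longrightarrow> \<bar>v i\<bar> \<le> 1"
    and Q: "Q > 0" "\<And>s t. Q * (s\<^sup>2 + t\<^sup>2) \<le> (\<Sum>i\<in>A. (s * u i + t * v i)\<^sup>2)"
    and R: "R > 0" "2 \<le> s0 * R"
  shows "prob {\<omega> \<in> space M. \<bar>\<Sum>i\<in>A. u i * X i \<omega>\<bar> \<le> R \<and> \<bar>\<Sum>i\<in>A. v i * X i \<omega>\<bar> \<le> R} \<le> 4096 * R\<^sup>2 / Q"
proof -
  have rv[measurable]: "random_variable borel (X i)" if "i \<in> A" for i
    using indep that by (simp add: indep_vars_def)
  define U where "U \<omega> = (\<Sum>i\<in>A. u i * X i \<omega>)" for \<omega>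
  define V where "V \<omega> = (\<Sum>i\<in>A. v i * X i \<omega>)" for \<omega>
  have [measurable]: "random_variable borel U" "random_variable borel V"
    unfolding U_def V_def by measurable
  \<comment> \<open>\<open>N\<close> is a free discretisation parameter that drops out of the final
    bound; it only has to be so large that \<open>\<tau> \<ge> 1\<close>.\<close>
  obtain N :: nat where N0: "max 1 (sqrt Q / (2 * R)) \<le> real N" using real_arch_simple by blast
  define \<tau> where "\<tau> = 2 * R * real N / sqrt Q"
  have N: "N > 0" using N0 by auto
  have \<tau>: "\<tau> \<ge> 1"
  proof -
    have "sqrt Q / (2 * R) \<le> real N" using N0 by simp
    then show ?thesis using Q(1) R(1) by (simp add: \<tau>_def field_simps)
  qed
  \<comment> \<open>Frequencies of the kernel rescaled to radius \<open>R\<close>. They are at most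
    \<open>1 / R\<close>, so a combination of \<open>u i\<close> and \<open>v i\<close> is at most
    \<open>2 / R\<close>, hence within \<open>s0\<close>: this is why \<open>R\<close> cannot go
    below the scale of one coefficient.\<close>
  define \<alpha> where "\<alpha> j k = (real j - real k) / real N / R" for j k :: nat
  have \<alpha>: "\<bar>\<alpha> j k\<bar> \<le> 1 / R" if "j < N" "k < N" for j k
  proof -
    have "\<bar>real j - real k\<bar> \<le> real N" using that by linarith
    then have "\<bar>real j - real k\<bar> / real N \<le> 1" using N by (simp add: divide_le_eq)
    then have "\<bar>real j - real k\<bar> / real N / R \<le> 1 / R" using R(1) by (intro divide_right_mono) auto
    then show ?thesis using R(1) by (simp add: \<alpha>_def abs_divide)
  qed
  define e where "e j k = exp (- ((real j - real k) / \<tau>)\<^sup>2)" for j k :: nat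
  have e\<alpha>: "exp (- Q * (\<alpha> j k)\<^sup>2 / 4) = e j k" for j k
  proof -
    have "\<tau>\<^sup>2 = 4 * R\<^sup>2 * (real N)\<^sup>2 / Q"
      unfolding \<tau>_def using Q(1) by (simp add: power_divide power_mult_distrib)
    then have "((real j - real k) / \<tau>)\<^sup>2 = Q * (\<alpha> j k)\<^sup>2 / 4"
      unfolding \<alpha>_def by (simp add: power_divide power_mult_distrib mult_ac)
    then show ?thesis by (simp add: e_def)
  qed
  have cos_bd: "expectation (\<lambda>\<omega>. cos (\<alpha> j k * U \<omega>) * cos (\<alpha> j' k' * V \<omega>)) \<le> e j k * e j' k'"
    if "j < N" "k < N" "j' < N" "k' < N" for j k j' k'
  proof -
    have one: "expectation (\<lambda>\<omega>. cos (s * U \<omega> + t * V \<omega>)) \<le> exp (- (Q * (s\<^sup>2 + t\<^sup>2)) / 4)"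
      if st: "\<bar>s\<bar> \<le> 1 / R" "\<bar>t\<bar> \<le> 1 / R" for s t
    proof -
      have h1: "s * U \<omega> + t * V \<omega> = (\<Sum>i\<in>A. (s * u i + t * v i) * X i \<omega>)" for \<omega>
        unfolding U_def V_def sum_distrib_left sum.distrib[symmetric]
        by (intro sum.cong refl) (simp add: algebra_simps)
      have h2: "expectation (\<lambda>\<omega>. cos (\<Sum>i\<in>A. (s * u i + t * v i) * X i \<omega>)) \<le>
          exp (- (\<Sum>i\<in>A. (s * u i + t * v i)\<^sup>2) / 4)"
      proof (rule expectation_cos_sum_le[OF A indep char])
        fix i assume i: "i \<in> A"
        have "\<bar>s * u i\<bar> \<le> 1 / R * 1" "\<bar>t * v i\<bar> \<le> 1 / R * 1"
          unfolding abs_mult using st uv i R(1) by (intro mult_mono; simp)+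
        then have "\<bar>s * u i + t * v i\<bar> \<le> 2 / R" by simp
        also have "2 / R \<le> s0" using R by (simp add: divide_le_eq)
        finally show "\<bar>s * u i + t * v i\<bar> \<le> s0" .
      qed
      have h3: "exp (- (\<Sum>i\<in>A. (s * u i + t * v i)\<^sup>2) / 4) \<le> exp (- (Q * (s\<^sup>2 + t\<^sup>2)) / 4)"
        using Q(2)[of s t] by simp
      show ?thesis unfolding h1 using h2 h3 by (rule order_trans)
    qed
    let ?s = "\<alpha> j k" and ?t = "\<alpha> j' k'"
    have bnd: "integrable M (\<lambda>\<omega>. cos (f \<omega>))" if [measurable]: "f \<in> borel_measurable M" for f :: "'a \<Rightarrow> real"
      by (intro integrable_const_bound[where B=1]) auto
    \<comment> \<open>The product becomes a mean of two cosines of linear forms. They differ in the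
      sign of \<open>?t\<close>, which the bound through \<open>?s^2 + ?t^2\<close> does not
      see.\<close>
    have "expectation (\<lambda>\<omega>. cos (?s * U \<omega>) * cos (?t * V \<omega>)) =
        expectation (\<lambda>\<omega>. (cos (?s * U \<omega> + ?t * V \<omega>) + cos (?s * U \<omega> + (- ?t) * V \<omega>)) / 2)"
      by (intro Bochner_Integration.integral_cong refl) (simp add: cos_add cos_diff)
    also have "\<dots> = (expectation (\<lambda>\<omega>. cos (?s * U \<omega> + ?t * V \<omega>)) + expectation (\<lambda>\<omega>. cos (?s * U \<omega> + (- ?t) * V \<omega>))) / 2"
      by (subst Bochner_Integration.integral_add[symmetric]) (auto intro!: bnd)
    also have "\<dots> \<le> exp (- (Q * (?s\<^sup>2 + ?t\<^sup>2)) / 4)"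
      using one[of ?s ?t] one[of ?s "- ?t"] \<alpha> that by (simp add: power2_minus)
    also have "\<dots> = exp (- Q * ?s\<^sup>2 / 4) * exp (- Q * ?t\<^sup>2 / 4)"
    proof -
      have "- (Q * (?s\<^sup>2 + ?t\<^sup>2)) / 4 = - Q * ?s\<^sup>2 / 4 + - Q * ?t\<^sup>2 / 4" by (simp add: field_simps)
      then show ?thesis by (simp only: exp_add)
    qed
    finally show ?thesis unfolding e\<alpha> .
  qed
  have F_eq: "fejer N (U \<omega> / R) * fejer N (V \<omega> / R) =
     1 / (real N) ^ 4 * (\<Sum>j<N. \<Sum>k<N. \<Sum>j'<N. \<Sum>k'<N. cos (\<alpha> j k * U \<omega>) * cos (\<alpha> j' k' * V \<omega>))" for \<omega>
  proof -
    have a: "fejer N (W / R) = 1 / (real N)\<^sup>2 * (\<Sum>j<N. \<Sum>k<N. cos (\<alpha> j k * W))" for W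
      by (simp add: fejer_def \<alpha>_def)
    have "(1 / (real N)\<^sup>2) * (1 / (real N)\<^sup>2) = 1 / (real N) ^ 4" by (simp flip: power_add)
    then have "x * (1 / (real N)\<^sup>2) * (y * (1 / (real N)\<^sup>2)) = 1 / (real N) ^ 4 * (x * y)" for x y
      by (metis mult.assoc mult.commute)
    then show ?thesis unfolding a double_sum_product[symmetric] by (simp only: mult.commute[of "1 / (real N)\<^sup>2"])
  qed
  have bnd: "integrable M (\<lambda>\<omega>. cos (a * U \<omega>) * cos (b * V \<omega>))" for a b
  proof (intro integrable_const_bound[where B=1] AE_I2)
    show "norm (cos (a * U \<omega>) * cos (b * V \<omega>)) \<le> 1" for \<omega>
      using mult_mono[of "\<bar>cos (a * U \<omega>)\<bar>" 1 "\<bar>cos (b * V \<omega>)\<bar>" 1] by (simp add: abs_mult)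
  qed measurable
  have intF: "integrable M (\<lambda>\<omega>. fejer N (U \<omega> / R) * fejer N (V \<omega> / R))"
    unfolding F_eq by (intro integrable_mult_right Bochner_Integration.integrable_sum bnd)
  let ?E = "\<Sum>j<N. \<Sum>k<N. \<Sum>j'<N. \<Sum>k'<N. expectation (\<lambda>\<omega>. cos (\<alpha> j k * U \<omega>) * cos (\<alpha> j' k' * V \<omega>))"
  have "?E \<le> (\<Sum>j<N. \<Sum>k<N. \<Sum>j'<N. \<Sum>k'<N. e j k * e j' k')"
    by (intro sum_mono cos_bd) auto
  also have "\<dots> = (\<Sum>j<N. \<Sum>k<N. e j k)\<^sup>2"
    by (simp only: power2_eq_square double_sum_product)
  also have "\<dots> \<le> (real N * (8 * \<tau>))\<^sup>2"
  proof (rule power_mono)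
    have "(\<Sum>j<N. \<Sum>k<N. e j k) \<le> (\<Sum>j<N. 8 * \<tau>)"
      unfolding e_def by (intro sum_mono gaussian_sum_le \<tau>)
    then show "(\<Sum>j<N. \<Sum>k<N. e j k) \<le> real N * (8 * \<tau>)" by simp
    show "0 \<le> (\<Sum>j<N. \<Sum>k<N. e j k)" unfolding e_def by (intro sum_nonneg) auto
  qed
  finally have "1 / (real N) ^ 4 * ?E \<le> 1 / (real N) ^ 4 * (real N * (8 * \<tau>))\<^sup>2"
    by (intro mult_left_mono) auto
  \<comment> \<open>The factor is \<open>64 * \<tau>^2 / N^2\<close>, and \<open>\<tau>\<close> is
    proportional to \<open>N\<close>.\<close>
  moreover have "1 / (real N) ^ 4 * (real N * (8 * \<tau>))\<^sup>2 = 256 * R\<^sup>2 / Q"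
  proof -
    have "\<tau>\<^sup>2 = 4 * R\<^sup>2 * (real N)\<^sup>2 / Q"
      unfolding \<tau>_def using Q(1) by (simp add: power_divide power_mult_distrib)
    then show ?thesis using N by (simp add: power_mult_distrib eval_nat_numeral)
  qed
  moreover have "expectation (\<lambda>\<omega>. fejer N (U \<omega> / R) * fejer N (V \<omega> / R)) = 1 / (real N) ^ 4 * ?E"
    unfolding F_eq
    by (simp add: Bochner_Integration.integral_sum Bochner_Integration.integrable_sum bnd)
  ultimately have EF: "expectation (\<lambda>\<omega>. fejer N (U \<omega> / R) * fejer N (V \<omega> / R)) \<le> 256 * R\<^sup>2 / Q"
    by linarith
  let ?S = "{\<omega> \<in> space M. \<bar>U \<omega>\<bar> \<le> R \<and> \<bar>V \<omega>\<bar> \<le> R}"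
  have S: "?S \<in> events" by measurable
  \<comment> \<open>Each of the two kernels is at least 1/4 on \<open>?S\<close>; the loss of 16
    turns 256 into 4096.\<close>
  have "1 / 16 * prob ?S = expectation (\<lambda>\<omega>. 1 / 16 * indicator ?S \<omega>)"
    using S by simp
  also have "\<dots> \<le> expectation (\<lambda>\<omega>. fejer N (U \<omega> / R) * fejer N (V \<omega> / R))"
  proof (rule integral_mono[OF _ intF])
    show "integrable M (\<lambda>\<omega>. 1 / 16 * indicator ?S \<omega> :: real)" 
      by (intro integrable_mult_right integrable_real_indicator S) (simp add: less_top[symmetric])
    fix \<omega> assume \<omega>: "\<omega> \<in> space M"
    show "1 / 16 * indicator ?S \<omega> \<le> fejer N (U \<omega> / R) * fejer N (V \<omega> / R)"
    proof (cases "\<omega> \<in> ?S")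
      case True
      then have "\<bar>U \<omega> / R\<bar> \<le> 1" "\<bar>V \<omega> / R\<bar> \<le> 1" using R(1) by (auto simp: abs_divide)
      then have "1 / 4 * (1 / 4) \<le> fejer N (U \<omega> / R) * fejer N (V \<omega> / R)"
        by (intro mult_mono fejer_ge N fejer_nonneg) auto
      then show ?thesis using True by simp
    next
      case False
      have "0 \<le> fejer N (U \<omega> / R) * fejer N (V \<omega> / R)" by (intro mult_nonneg_nonneg fejer_nonneg)
      with False show ?thesis unfolding indicator_simps(2)[OF False] by simp
    qed
  qed
  finally have "prob ?S \<le> 16 * (256 * R\<^sup>2 / Q)" using EF by linarith
  then show ?thesis unfolding U_def V_def by simp
qed

text \<open>Needed for \<open>prod.swap\<close>, which exchanges the roles of rows and columns of
  the coefficients.\<close>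

lemma indep_vars_reindex:
  assumes indep: "indep_vars M' X (f ` I)" and inj: "inj_on f I"
  shows "indep_vars (\<lambda>i. M' (f i)) (\<lambda>i. X (f i)) I"
  unfolding indep_vars_def2
proof (intro conjI ballI)
  fix i assume "i \<in> I"
  then show "random_variable (M' (f i)) (X (f i))" using indep unfolding indep_vars_def2 by auto
next
  let ?F = "\<lambda>i. {X i -` A \<inter> space M |A. A \<in> sets (M' i)}"
  have F: "indep_sets ?F (f ` I)" using indep unfolding indep_vars_def2 by auto
  show "indep_sets (\<lambda>i. ?F (f i)) I"
    unfolding indep_sets_def
  proof (intro conjI ballI allI impI)
    fix i assume "i \<in> I" then show "?F (f i) \<subseteq> events" using F unfolding indep_sets_def by auto
  next
    fix J A assume J: "J \<subseteq> I" "J \<noteq> {}" "finite J" and A: "A \<in> Pi J (\<lambda>i. ?F (f i))"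
    have injJ: "inj_on f J" using inj J(1) by (rule inj_on_subset)
    define B where "B k = A (the_inv_into J f k)" for k
    have B: "B (f j) = A j" if "j \<in> J" for j using that by (simp add: B_def the_inv_into_f_f[OF injJ])
    have "prob (\<Inter>k\<in>f ` J. B k) = (\<Prod>k\<in>f ` J. prob (B k))"
      using F J A B unfolding indep_sets_def
      by (elim conjE allE[of _ "f ` J"] impE ballE[of _ _ B]) (auto simp: Pi_iff)
    then show "prob (\<Inter>j\<in>J. A j) = (\<Prod>j\<in>J. prob (A j))"
      using B by (simp add: prod.reindex[OF injJ])
  qed
qed

end

section \<open>The nodal set of a cosine polynomial\<close>

definition line_coeff :: "(nat \<Rightarrow> nat \<Rightarrow> real) \<Rightarrow> nat \<Rightarrow> real \<Rightarrow> nat \<Rightarrow> real" where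
  "line_coeff c n x j = (1 / real n) * (\<Sum>i = 1..n. c i j * cos (real i * x / real n))"

definition line_coeff_deriv :: "(nat \<Rightarrow> nat \<Rightarrow> real) \<Rightarrow> nat \<Rightarrow> real \<Rightarrow> nat \<Rightarrow> real" where
  "line_coeff_deriv c n x j = (1 / real n) * (\<Sum>i = 1..n. c i j * (- sin (real i * x / real n) * (real i / real n)))"

lemma cos_poly_eq_cos_sum_deriv: "cos_poly c n (x, y) = cos_sum_deriv (line_coeff c n x) n 0 y"
proof -
  have "(\<Sum>i = 1..n. \<Sum>j = 1..n. c i j * cos (real i * x / real n) * cos (real j * y / real n)) =
      (\<Sum>j = 1..n. (\<Sum>i = 1..n. c i j * cos (real i * x / real n)) * cos (real j * y / real n))"
    by (subst sum.swap) (simp only: sum_distrib_right)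
  then have "cos_poly c n (x, y) = 1 / real n *
      (\<Sum>j = 1..n. (\<Sum>i = 1..n. c i j * cos (real i * x / real n)) * cos (real j * y / real n))"
    by (simp only: cos_poly_def prod.case)
  also have "\<dots> = cos_sum_deriv (line_coeff c n x) n 0 y"
    unfolding cos_sum_deriv_def line_coeff_def by (subst sum_distrib_left) (intro sum.cong refl, simp)
  finally show ?thesis .
qed

text \<open>Exchanging the variables transposes the coefficients, so statements on vertical slices
  yield those on horizontal ones.\<close>

lemma cos_poly_transpose: "cos_poly (\<lambda>i j. c j i) n (y, x) = cos_poly c n (x, y)"
proof -
  have "(\<Sum>i = 1..n. \<Sum>j = 1..n. c j i * cos (real i * y / real n) * cos (real j * x / real n)) =
      (\<Sum>j = 1..n. \<Sum>i = 1..n. c j i * cos (real j * x / real n) * cos (real i * y / real n))"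
    by (subst sum.swap) (simp add: mult_ac)
  then show ?thesis unfolding cos_poly_def by simp
qed

section \<open>Gradients and the local structure of the zero set\<close>

lemma cos_sum_deriv_line_deriv:
  "((\<lambda>t. cos_sum_deriv (line_coeff c n (x + t * dx)) n m (y + t * dy)) has_real_derivative
     dx * cos_sum_deriv (line_coeff_deriv c n (x + t * dx)) n m (y + t * dy) +
     dy * cos_sum_deriv (line_coeff c n (x + t * dx)) n (Suc m) (y + t * dy)) (at t)"
proof -
  have lcd: "((\<lambda>t. line_coeff c n (x + t * dx) j) has_real_derivative dx * line_coeff_deriv c n (x + t * dx) j) (at t)" for j
    unfolding line_coeff_def line_coeff_deriv_def
    by (auto intro!: derivative_eq_intros sum.cong simp: sum_distrib_left mult_ac)
  have cosd: "((\<lambda>t. cos (real j * (y + t * dy) / real n + real m * pi / 2)) has_real_derivative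
      dy * (real j / real n) * cos (real j * (y + t * dy) / real n + real (Suc m) * pi / 2)) (at t)" for j
  proof -
    have "real j * (y + t * dy) / real n + real (Suc m) * pi / 2 =
        (real j * (y + t * dy) / real n + real m * pi / 2) + pi / 2" by (simp add: field_simps)
    then have s: "cos (real j * (y + t * dy) / real n + real (Suc m) * pi / 2) =
        - sin (real j * (y + t * dy) / real n + real m * pi / 2)" by (simp only: cos_add) simp
    have "((\<lambda>t. cos (w * (y + t * dy) + b)) has_real_derivative - sin (w * (y + t * dy) + b) * (w * dy)) (at t)" for w b
      by (auto intro!: derivative_eq_intros)
    from this[of "real j / real n" "real m * pi / 2"] show ?thesis unfolding s by (simp add: mult_ac)
  qed
  have "((\<lambda>t. \<Sum>j = 1..n. (real j / real n) ^ m *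
        (line_coeff c n (x + t * dx) j * cos (real j * (y + t * dy) / real n + real m * pi / 2))) has_real_derivative
     (\<Sum>j = 1..n. (real j / real n) ^ m * (dx * line_coeff_deriv c n (x + t * dx) j * cos (real j * (y + t * dy) / real n + real m * pi / 2) +
       dy * (real j / real n) * cos (real j * (y + t * dy) / real n + real (Suc m) * pi / 2) * line_coeff c n (x + t * dx) j))) (at t)"
    by (intro DERIV_sum DERIV_cmult DERIV_mult lcd cosd)
  moreover have "(\<Sum>j = 1..n. (real j / real n) ^ m * (dx * line_coeff_deriv c n (x + t * dx) j * cos (real j * (y + t * dy) / real n + real m * pi / 2) +
       dy * (real j / real n) * cos (real j * (y + t * dy) / real n + real (Suc m) * pi / 2) * line_coeff c n (x + t * dx) j)) =
     dx * cos_sum_deriv (line_coeff_deriv c n (x + t * dx)) n m (y + t * dy) +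
     dy * cos_sum_deriv (line_coeff c n (x + t * dx)) n (Suc m) (y + t * dy)"
    unfolding cos_sum_deriv_def sum_distrib_left sum.distrib[symmetric]
    by (intro sum.cong refl) (simp only: power_Suc distrib_left mult_ac)
  moreover have "(\<lambda>t. cos_sum_deriv (line_coeff c n (x + t * dx)) n m (y + t * dy)) =
     (\<lambda>t. \<Sum>j = 1..n. (real j / real n) ^ m *
        (line_coeff c n (x + t * dx) j * cos (real j * (y + t * dy) / real n + real m * pi / 2)))"
    unfolding cos_sum_deriv_def by (intro ext sum.cong refl) (simp only: mult_ac)
  ultimately show ?thesis by simp
qed

lemma continuous_on_cos_sum_deriv_line:
  "continuous_on UNIV (\<lambda>p. cos_sum_deriv (line_coeff c n (fst p)) n m (snd p))"
  "continuous_on UNIV (\<lambda>p. cos_sum_deriv (line_coeff_deriv c n (fst p)) n m (snd p))"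
  unfolding cos_sum_deriv_def line_coeff_def line_coeff_deriv_def divide_inverse by (intro continuous_intros)+

text \<open>One-dimensional mean value theorem along the chord between two zeros. Convexity keeps
  the intermediate point in the ball, where the ratio of the partial derivatives is under
  control.\<close>

lemma cos_sum_deriv_line_mvt:
  assumes p: "p \<in> ball z r" and q: "q \<in> ball z r"
    and G: "cos_sum_deriv (line_coeff c n (fst p)) n m (snd p) = 0" "cos_sum_deriv (line_coeff c n (fst q)) n m (snd q) = 0"
  obtains w where "w \<in> ball z r"
    "(fst q - fst p) * cos_sum_deriv (line_coeff_deriv c n (fst w)) n m (snd w) +
     (snd q - snd p) * cos_sum_deriv (line_coeff c n (fst w)) n (Suc m) (snd w) = 0"
proof -
  define \<phi> where "\<phi> t = cos_sum_deriv (line_coeff c n (fst p + t * (fst q - fst p))) n m (snd p + t * (snd q - snd p))" for t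
  define w where "w t = p + t *\<^sub>R (q - p)" for t
  have w: "fst (w t) = fst p + t * (fst q - fst p)" "snd (w t) = snd p + t * (snd q - snd p)" for t
    by (simp_all add: w_def)
  have "\<exists>t. 0 < t \<and> t < 1 \<and> \<phi> 1 - \<phi> 0 = (1 - 0) *
     ((fst q - fst p) * cos_sum_deriv (line_coeff_deriv c n (fst (w t))) n m (snd (w t)) +
      (snd q - snd p) * cos_sum_deriv (line_coeff c n (fst (w t))) n (Suc m) (snd (w t)))"
    unfolding w \<phi>_def by (rule MVT2) (auto intro!: cos_sum_deriv_line_deriv)
  then obtain t where t: "0 < t" "t < 1" "\<phi> 1 - \<phi> 0 =
     (fst q - fst p) * cos_sum_deriv (line_coeff_deriv c n (fst (w t))) n m (snd (w t)) +
      (snd q - snd p) * cos_sum_deriv (line_coeff c n (fst (w t))) n (Suc m) (snd (w t))" by auto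
  have "w t = (1 - t) *\<^sub>R p + t *\<^sub>R q" by (simp add: w_def algebra_simps)
  then have "w t \<in> ball z r" using convexD[OF convex_ball p q, of "1 - t" t] t by simp
  moreover have "\<phi> 1 - \<phi> 0 = 0" using G by (simp add: \<phi>_def)
  ultimately show ?thesis using that[of "w t"] t(3) by simp
qed

text \<open>The index \<open>m\<close> is one less than the order of the zero \<open>y\<close>, so that the gradient of the \<open>m\<close>-th
  \<open>y\<close>-derivative does not vanish at \<open>(x, y)\<close>.\<close>

lemma zero_set_locally_lipschitz:
  assumes nz: "cos_sum_deriv (line_coeff c n x) n 0 y1 \<noteq> 0" and z: "cos_sum_deriv (line_coeff c n x) n 0 y = 0"
  obtains m r where "r > 0" "cos_sum_deriv (line_coeff c n x) n m y = 0"
    "xlip ({p. cos_sum_deriv (line_coeff c n (fst p)) n m (snd p) = 0} \<inter> ball (x, y) r) \<or>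
     ylip ({p. cos_sum_deriv (line_coeff c n (fst p)) n m (snd p) = 0} \<inter> ball (x, y) r)"
proof -
  have "\<exists>k. cos_sum_deriv (line_coeff c n x) n k y \<noteq> 0" using cos_sum_deriv_eq_0_if_all_derivs_0 nz by blast
  then obtain k where k: "cos_sum_deriv (line_coeff c n x) n k y \<noteq> 0" "\<And>i. i < k \<Longrightarrow> cos_sum_deriv (line_coeff c n x) n i y = 0"
    using exists_least_iff[of "\<lambda>k. cos_sum_deriv (line_coeff c n x) n k y \<noteq> 0"] by blast
  have "k \<noteq> 0" using k(1) z by (cases k) auto
  then obtain m where m: "k = Suc m" by (cases k) auto
  define Gx where "Gx p = cos_sum_deriv (line_coeff_deriv c n (fst p)) n m (snd p)" for p
  define Gy where "Gy p = cos_sum_deriv (line_coeff c n (fst p)) n (Suc m) (snd p)" for p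
  have cont: "continuous_on UNIV Gx" "continuous_on UNIV Gy"
    unfolding Gx_def Gy_def by (rule continuous_on_cos_sum_deriv_line)+
  have Gy0: "Gy (x, y) \<noteq> 0" using k(1) m by (simp add: Gy_def)
  have Gm: "cos_sum_deriv (line_coeff c n x) n m y = 0" using k(2) m by simp
  \<comment> \<open>As \<open>Gy\<close> is non-zero here, one of the two strict inequalities holds.
    It persists on a ball and bounds the slopes of chords between zeros there by 2.\<close>
  consider (a) "\<bar>Gx (x, y)\<bar> < 2 * \<bar>Gy (x, y)\<bar>" | (b) "\<bar>Gy (x, y)\<bar> < 2 * \<bar>Gx (x, y)\<bar>"
    using Gy0 by linarith
  then show ?thesis
  proof cases
    case a
    have "open {p. \<bar>Gx p\<bar> < 2 * \<bar>Gy p\<bar>}"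
      by (intro open_Collect_less continuous_intros cont)
    then obtain r where r: "r > 0" "ball (x, y) r \<subseteq> {p. \<bar>Gx p\<bar> < 2 * \<bar>Gy p\<bar>}"
      using a by (metis (mono_tags, lifting) mem_Collect_eq open_contains_ball)
    have "xlip ({p. cos_sum_deriv (line_coeff c n (fst p)) n m (snd p) = 0} \<inter> ball (x, y) r)"
      unfolding xlip_def
    proof (intro ballI)
      fix p q assume pq: "p \<in> {p. cos_sum_deriv (line_coeff c n (fst p)) n m (snd p) = 0} \<inter> ball (x, y) r"
        "q \<in> {p. cos_sum_deriv (line_coeff c n (fst p)) n m (snd p) = 0} \<inter> ball (x, y) r"
      obtain w where w: "w \<in> ball (x, y) r" "(fst q - fst p) * Gx w + (snd q - snd p) * Gy w = 0"
        using cos_sum_deriv_line_mvt[of p "(x, y)" r q c n m] pq unfolding Gx_def Gy_def by auto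
      have lt: "\<bar>Gx w\<bar> < 2 * \<bar>Gy w\<bar>" using r(2) w(1) by auto
      then have pos: "\<bar>Gy w\<bar> > 0" by linarith
      have "\<bar>snd q - snd p\<bar> * \<bar>Gy w\<bar> = \<bar>fst q - fst p\<bar> * \<bar>Gx w\<bar>"
        using w(2) unfolding abs_mult[symmetric] by (metis abs_minus_cancel add_eq_0_iff)
      also have "\<dots> \<le> \<bar>fst q - fst p\<bar> * (2 * \<bar>Gy w\<bar>)" using lt by (intro mult_left_mono) auto
      also have "\<dots> = (2 * \<bar>fst q - fst p\<bar>) * \<bar>Gy w\<bar>" by simp
      finally have "\<bar>snd q - snd p\<bar> \<le> 2 * \<bar>fst q - fst p\<bar>" using pos by (rule mult_right_le_imp_le)
      then show "\<bar>snd p - snd q\<bar> \<le> 2 * \<bar>fst p - fst q\<bar>" by (simp add: abs_minus_commute)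
    qed
    then show ?thesis using that r(1) Gm by blast
  next
    case b
    have "open {p. \<bar>Gy p\<bar> < 2 * \<bar>Gx p\<bar>}"
      by (intro open_Collect_less continuous_intros cont)
    then obtain r where r: "r > 0" "ball (x, y) r \<subseteq> {p. \<bar>Gy p\<bar> < 2 * \<bar>Gx p\<bar>}"
      using b by (metis (mono_tags, lifting) mem_Collect_eq open_contains_ball)
    have "ylip ({p. cos_sum_deriv (line_coeff c n (fst p)) n m (snd p) = 0} \<inter> ball (x, y) r)"
      unfolding ylip_def
    proof (intro ballI)
      fix p q assume pq: "p \<in> {p. cos_sum_deriv (line_coeff c n (fst p)) n m (snd p) = 0} \<inter> ball (x, y) r"
        "q \<in> {p. cos_sum_deriv (line_coeff c n (fst p)) n m (snd p) = 0} \<inter> ball (x, y) r"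
      obtain w where w: "w \<in> ball (x, y) r" "(fst q - fst p) * Gx w + (snd q - snd p) * Gy w = 0"
        using cos_sum_deriv_line_mvt[of p "(x, y)" r q c n m] pq unfolding Gx_def Gy_def by auto
      have lt: "\<bar>Gy w\<bar> < 2 * \<bar>Gx w\<bar>" using r(2) w(1) by auto
      then have pos: "\<bar>Gx w\<bar> > 0" by linarith
      have "\<bar>fst q - fst p\<bar> * \<bar>Gx w\<bar> = \<bar>snd q - snd p\<bar> * \<bar>Gy w\<bar>"
        using w(2) unfolding abs_mult[symmetric] by (metis abs_minus_cancel add_eq_0_iff)
      also have "\<dots> \<le> \<bar>snd q - snd p\<bar> * (2 * \<bar>Gx w\<bar>)" using lt by (intro mult_left_mono) auto
      also have "\<dots> = (2 * \<bar>snd q - snd p\<bar>) * \<bar>Gx w\<bar>" by simp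
      finally have "\<bar>fst q - fst p\<bar> \<le> 2 * \<bar>snd q - snd p\<bar>" using pos by (rule mult_right_le_imp_le)
      then show "\<bar>fst p - fst q\<bar> \<le> 2 * \<bar>snd p - snd q\<bar>" by (simp add: abs_minus_commute)
    qed
    then show ?thesis using that r(1) Gm by blast
  qed
qed

section \<open>A measurable majorant for the number of zeros\<close>

definition level_bound :: "nat \<Rightarrow> real" where
  "level_bound m = exp (2 * pi) * (4 * pi) ^ m / fact m"

text \<open>A condition on the coefficients that is forced by \<open>m\<close> zeros on the slice over \<open>x\<close>, see
  \<open>card_zeros_le_levels\<close>. Unlike the number of zeros it is obviously measurable.\<close>

definition zero_level :: "(nat \<Rightarrow> nat \<Rightarrow> real) \<Rightarrow> nat \<Rightarrow> nat \<Rightarrow> real \<Rightarrow> nat \<Rightarrow> bool" where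
  "zero_level c n l x m \<longleftrightarrow>
     (\<exists>j. \<bar>cos_sum_deriv (line_coeff c n x) n j (real l * pi)\<bar> > 2 ^ (m + j)) \<or>
     (\<bar>cos_sum_deriv (line_coeff c n x) n 0 (real l * pi)\<bar> \<le> level_bound m \<and>
      \<bar>cos_sum_deriv (line_coeff c n x) n 0 (real (Suc l) * pi)\<bar> \<le> level_bound m)"

text \<open>Discarding zeros shows that every \<open>m\<close> up to \<open>card Y\<close> is a
  level. Larger \<open>m\<close> may be levels too, so the levels need not form an initial segment;
  counting all of them still gives an upper bound.\<close>

lemma card_zeros_le_levels:
  assumes n: "n \<ge> 1" and l: "l \<le> n - 1" and nz: "cos_sum_deriv (line_coeff c n x) n 0 y0 \<noteq> 0"
    and Y: "finite Y" "Y \<subseteq> {real l * pi..(real l + 1) * pi}" "\<And>y. y \<in> Y \<Longrightarrow> cos_sum_deriv (line_coeff c n x) n 0 y = 0"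
  shows "card Y \<le> card {m \<in> {1..n}. zero_level c n l x m}"
proof -
  have cn: "card Y \<le> n" by (rule cos_sum_deriv_card_zeros[OF n l nz Y])
  have "zero_level c n l x m" if m: "m \<le> card Y" for m
  proof -
    obtain Y' where Y': "Y' \<subseteq> Y" "card Y' = m" "finite Y'" using obtain_subset_with_card_n[OF m] by blast
    have I: "{real l * pi..(real l + 1) * pi} = {real l * pi..real l * pi + pi}"
      by (simp add: distrib_right)
    show ?thesis
    proof (cases "\<exists>j. \<bar>cos_sum_deriv (line_coeff c n x) n j (real l * pi)\<bar> > 2 ^ (m + j)")
      case False
      then have b: "\<bar>cos_sum_deriv (line_coeff c n x) n j (real l * pi)\<bar> \<le> 2 ^ (m + j)" for j by (meson not_less)
      have "\<bar>cos_sum_deriv (line_coeff c n x) n 0 y\<bar> \<le> level_bound m" if "y \<in> {real l * pi..real l * pi + pi}" for y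
        unfolding level_bound_def
        using Y' Y I by (intro cos_sum_deriv_abs_le_of_zeros[OF Y'(3,2) _ _ b that]) auto
      then show ?thesis unfolding zero_level_def by (simp add: distrib_right)
    qed (simp add: zero_level_def)
  qed
  then have "{1..card Y} \<subseteq> {m \<in> {1..n}. zero_level c n l x m}" using cn by auto
  then have "card {1..card Y} \<le> card {m \<in> {1..n}. zero_level c n l x m}" by (intro card_mono) auto
  then show ?thesis by simp
qed

text \<open>Cut off at \<open>n\<close> because the part \<open>n^-2\<close> of the probability of a
  level does not decay in \<open>m\<close>.\<close>

definition level_count :: "(nat \<Rightarrow> nat \<Rightarrow> real) \<Rightarrow> nat \<Rightarrow> nat \<Rightarrow> real \<Rightarrow> ennreal" where
  "level_count c n l x = of_nat (card {m \<in> {1..n}. zero_level c n l x m})"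

text \<open>Each vertical line on which the polynomial vanishes meets a fixed horizontal line in a
  zero. If the polynomial is not identically zero on the latter, there are at most \<open>n\<close>
  such zeros.\<close>

lemma finite_vanishing_lines:
  assumes n: "n \<ge> 1" and k: "k \<le> n - 1" and nz: "\<exists>p. cos_poly c n p \<noteq> 0"
  shows "finite {x \<in> {real k * pi..(real k + 1) * pi}. \<forall>y. cos_poly c n (x, y) = 0}" (is "finite ?B")
proof (rule ccontr)
  assume inf: "infinite ?B"
  obtain Y where Y: "finite Y" "card Y = Suc n" "Y \<subseteq> ?B"
    using infinite_arbitrarily_large[OF inf, of "Suc n"] by blast
  obtain x1 y1 where nz1: "cos_poly c n (x1, y1) \<noteq> 0" using nz by auto
  have T: "cos_sum_deriv (line_coeff (\<lambda>i j. c j i) n y1) n 0 x = cos_poly c n (x, y1)" for x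
    unfolding cos_poly_eq_cos_sum_deriv[symmetric] by (rule cos_poly_transpose)
  have "card Y \<le> n"
    by (rule cos_sum_deriv_card_zeros[OF n k, of "line_coeff (\<lambda>i j. c j i) n y1" x1]) (use T nz1 Y in auto)
  then show False using Y(2) by simp
qed

lemma AE_slice_le_level_count:
  assumes n: "n \<ge> 1" and k: "k \<le> n - 1" and l: "l \<le> n - 1" and nz: "\<exists>p. cos_poly c n p \<noteq> 0"
  shows "AE x in lborel. \<forall>Y. finite Y \<longrightarrow> Y \<subseteq> {y \<in> {real l * pi..(real l + 1) * pi}. x \<in> {real k * pi..(real k + 1) * pi} \<and> cos_poly c n (x, y) = 0} \<longrightarrow>
    of_nat (card Y) \<le> level_count c n l x * indicator {real k * pi..(real k + 1) * pi} x"
proof -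
  let ?J = "{real k * pi..(real k + 1) * pi}"
  let ?B = "{x \<in> ?J. \<forall>y. cos_poly c n (x, y) = 0}"
  have "AE x in lborel. x \<notin> ?B"
    by (intro AE_not_in finite_imp_null_set_lborel finite_vanishing_lines n k nz)
  then show ?thesis
  proof eventually_elim
    case (elim x)
    show ?case
    proof (intro allI impI)
      fix Y assume Y: "finite Y" "Y \<subseteq> {y \<in> {real l * pi..(real l + 1) * pi}. x \<in> ?J \<and> cos_poly c n (x, y) = 0}"
      show "of_nat (card Y) \<le> level_count c n l x * indicator ?J x"
      proof (cases "x \<in> ?J")
        case True
        then obtain y0 where y0: "cos_sum_deriv (line_coeff c n x) n 0 y0 \<noteq> 0" using elim by (auto simp: cos_poly_eq_cos_sum_deriv)
        have "card Y \<le> card {m \<in> {1..n}. zero_level c n l x m}"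
          by (rule card_zeros_le_levels[OF n l y0 Y(1)]) (use Y(2) in \<open>auto simp: cos_poly_eq_cos_sum_deriv\<close>)
        then show ?thesis using True by (simp add: level_count_def)
      next
        case False
        then have "Y = {}" using Y(2) by auto
        then show ?thesis by simp
      qed
    qed
  qed
qed

lemma nodal_length_le:
  assumes n: "n \<ge> 1" and k: "k \<le> n - 1" and l: "l \<le> n - 1" and nz: "\<exists>p. cos_poly c n p \<noteq> 0"
  shows "nodal_length (cos_poly c n) (pi_square k l) \<le>
    3 * (\<integral>\<^sup>+x\<in>{real k * pi..(real k + 1) * pi}. level_count c n l x \<partial>lborel) +
    3 * (\<integral>\<^sup>+y\<in>{real l * pi..(real l + 1) * pi}. level_count (\<lambda>i j. c j i) n k y \<partial>lborel)"
proof -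
  let ?J = "{real k * pi..(real k + 1) * pi}" and ?I = "{real l * pi..(real l + 1) * pi}"
  define G where "G m p = cos_sum_deriv (line_coeff c n (fst p)) n m (snd p)" for m p
  define B where "B = {x \<in> ?J. \<forall>y. cos_poly c n (x, y) = 0}"
  define Z where "Z = nodal_set (cos_poly c n) (pi_square k l)"
  have G0: "cos_poly c n p = G 0 p" for p unfolding G_def by (cases p) (simp add: cos_poly_eq_cos_sum_deriv)
  have clG: "closed {p. G m p = 0}" for m
    unfolding G_def by (intro closed_Collect_eq continuous_on_cos_sum_deriv_line continuous_on_const)
  have Z_eq: "Z = (?J \<times> ?I) \<inter> {p. G 0 p = 0}" unfolding Z_def nodal_set_def pi_square_def G0 by auto
  have compZ: "compact Z" unfolding Z_eq by (intro compact_Int_closed compact_Times compact_Icc clG)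
  have finB: "finite B" unfolding B_def by (rule finite_vanishing_lines[OF n k nz])
  \<comment> \<open>Off the nodal vertical lines every zero has finite order in \<open>y\<close>, so
    one of the zero sets of the y-derivatives is a Lipschitz graph nearby. On a nodal vertical line
    all y-derivatives vanish; the line itself serves there and is trivially
    \<open>ylip\<close>.\<close>
  let ?C = "range (\<lambda>m. {p. G m p = 0}) \<union> (\<lambda>x. {x} \<times> UNIV) ` B"
  have transp: "cos_poly (\<lambda>i j. c j i) n (y, x) = cos_poly c n (x, y)" for x y by (rule cos_poly_transpose)
  have nzT: "\<exists>p. cos_poly (\<lambda>i j. c j i) n p \<noteq> 0"
  proof -
    obtain x1 y1 where "cos_poly c n (x1, y1) \<noteq> 0" using nz by auto
    then have "cos_poly (\<lambda>i j. c j i) n (y1, x1) \<noteq> 0" using cos_poly_transpose[of c n y1 x1] by simp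
    then show ?thesis by blast
  qed
  have "hausdorff1 Z \<le> 3 * (\<integral>\<^sup>+x. level_count c n l x * indicator ?J x \<partial>lborel) +
      3 * (\<integral>\<^sup>+y. level_count (\<lambda>i j. c j i) n k y * indicator ?I y \<partial>lborel)"
  proof (rule hausdorff1_le_slices[OF compZ, of ?C])
    show "countable ?C" using finB by (intro countable_Un countable_image) (auto intro: countable_finite)
    show "closed C" if "C \<in> ?C" for C using that clG by (auto intro: closed_Times)
    show "\<exists>C\<in>?C. p \<in> C \<and> (\<exists>r>0. xlip (C \<inter> ball p r) \<or> ylip (C \<inter> ball p r))" if p: "p \<in> Z" for p
    proof (cases "fst p \<in> B")
      case True
      have "ylip (({fst p} \<times> UNIV) \<inter> ball p 1)" unfolding ylip_def by auto
      then show ?thesis using True by (intro bexI[of _ "{fst p} \<times> UNIV"]) (auto intro: exI[of _ 1] simp: mem_Times_iff)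
    next
      case False
      obtain x y where xy: "p = (x, y)" by (cases p)
      have x: "x \<in> ?J" "cos_sum_deriv (line_coeff c n x) n 0 y = 0" using p xy unfolding Z_eq G_def by auto
      then obtain y1 where y1: "cos_sum_deriv (line_coeff c n x) n 0 y1 \<noteq> 0"
        using False xy unfolding B_def by (auto simp: cos_poly_eq_cos_sum_deriv)
      obtain m r where mr: "r > 0" "cos_sum_deriv (line_coeff c n x) n m y = 0"
        "xlip ({p. cos_sum_deriv (line_coeff c n (fst p)) n m (snd p) = 0} \<inter> ball (x, y) r) \<or>
         ylip ({p. cos_sum_deriv (line_coeff c n (fst p)) n m (snd p) = 0} \<inter> ball (x, y) r)"
        by (rule zero_set_locally_lipschitz[OF y1 x(2)])
      show ?thesis
      proof (intro bexI[of _ "{p. G m p = 0}"] conjI exI[of _ r])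
        show "p \<in> {p. G m p = 0}" "r > 0" using mr xy by (auto simp: G_def)
        show "xlip ({p. G m p = 0} \<inter> ball p r) \<or> ylip ({p. G m p = 0} \<inter> ball p r)"
          using mr(3) unfolding G_def xy .
      qed blast
    qed
    show "AE x in lborel. \<forall>Y. finite Y \<longrightarrow> Y \<subseteq> {p \<in> Z. fst p = x} \<longrightarrow> of_nat (card Y) \<le> level_count c n l x * indicator ?J x"
      using AE_slice_le_level_count[OF n k l nz]
    proof eventually_elim
      case (elim x)
      show ?case
      proof (intro allI impI)
        fix Y assume Y: "finite Y" "Y \<subseteq> {p \<in> Z. fst p = x}"
        have "inj_on snd Y" using Y(2) by (auto simp: inj_on_def prod_eq_iff)
        then have "card Y = card (snd ` Y)" by (simp add: card_image)
        moreover have "snd ` Y \<subseteq> {y \<in> ?I. x \<in> ?J \<and> cos_poly c n (x, y) = 0}"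
          using Y(2) unfolding Z_eq G0 by auto
        ultimately show "of_nat (card Y) \<le> level_count c n l x * indicator ?J x"
          using elim Y(1) by simp
      qed
    qed
    show "AE y in lborel. \<forall>Y. finite Y \<longrightarrow> Y \<subseteq> {p \<in> Z. snd p = y} \<longrightarrow> of_nat (card Y) \<le> level_count (\<lambda>i j. c j i) n k y * indicator ?I y"
      using AE_slice_le_level_count[OF n l k nzT]
    proof eventually_elim
      case (elim y)
      show ?case
      proof (intro allI impI)
        fix Y assume Y: "finite Y" "Y \<subseteq> {p \<in> Z. snd p = y}"
        have "inj_on fst Y" using Y(2) by (auto simp: inj_on_def prod_eq_iff)
        then have "card Y = card (fst ` Y)" by (simp add: card_image)
        moreover have "fst ` Y \<subseteq> {x \<in> ?J. y \<in> ?I \<and> cos_poly (\<lambda>i j. c j i) n (y, x) = 0}"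
          using Y(2) unfolding Z_eq transp G0 by auto
        ultimately show "of_nat (card Y) \<le> level_count (\<lambda>i j. c j i) n k y * indicator ?I y"
          using elim Y(1) by simp
      qed
    qed
  qed
  then show ?thesis unfolding nodal_length_def Z_def .
qed

section \<open>Moments of the nodal length\<close>

text \<open>Linear form in the coefficients, indexed by pairs: second moments, measurability and the
  small-ball bound are read off from it.\<close>

lemma cos_sum_deriv_line_coeff_eq:
  "cos_sum_deriv (line_coeff c n x) n m y = (\<Sum>p\<in>{1..n} \<times> {1..n}.
     (1 / real n * (cos (real (fst p) * x / real n) * ((real (snd p) / real n) ^ m *
        cos (real (snd p) * y / real n + real m * pi / 2)))) * c (fst p) (snd p))"
proof -
  have "cos_sum_deriv (line_coeff c n x) n m y = (\<Sum>j = 1..n. \<Sum>i = 1..n.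
     (1 / real n * (cos (real i * x / real n) * ((real j / real n) ^ m *
        cos (real j * y / real n + real m * pi / 2)))) * c i j)"
    unfolding cos_sum_deriv_def line_coeff_def
    by (simp only: sum_distrib_left sum_distrib_right mult_ac)
  also have "\<dots> = (\<Sum>i = 1..n. \<Sum>j = 1..n.
     (1 / real n * (cos (real i * x / real n) * ((real j / real n) ^ m *
        cos (real j * y / real n + real m * pi / 2)))) * c i j)"
    by (rule sum.swap)
  also have "\<dots> = (\<Sum>(i, j)\<in>{1..n} \<times> {1..n}.
     (1 / real n * (cos (real i * x / real n) * ((real j / real n) ^ m *
        cos (real j * y / real n + real m * pi / 2)))) * c i j)"
    by (rule sum.cartesian_product)
  finally show ?thesis by (simp only: case_prod_unfold)
qed

text \<open>The k-th smallest element of \<open>S\<close> is at least \<open>k\<close>, and the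
  first odd numbers add up to a square. Excluding 0 keeps the subtraction on naturals exact.\<close>

lemma card_power2_le_sum_odd:
  assumes "finite S" "S \<subseteq> {1..}"
  shows "(card S)\<^sup>2 \<le> (\<Sum>m\<in>S. 2 * m - 1)"
  using assms
proof (induction S rule: finite_linorder_max_induct)
  case (insert b A)
  have "A \<subseteq> {1..<b}" using insert by auto
  then have "card A \<le> card {1..<b}" by (intro card_mono) auto
  then have c: "card A + 1 \<le> b" using insert.prems by auto
  have "b \<notin> A" using insert.hyps by auto
  then have "(card (insert b A))\<^sup>2 = (card A)\<^sup>2 + (2 * card A + 1)"
    using insert.hyps by (simp add: power2_eq_square)
  also have "\<dots> \<le> (\<Sum>m\<in>A. 2 * m - 1) + (2 * b - 1)"
    using insert c by (intro add_mono) auto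
  finally show ?case using insert.hyps \<open>b \<notin> A\<close> by simp
qed simp

lemma level_count_power2_le:
  "(level_count c n l x)\<^sup>2 \<le> (\<Sum>m = 1..n. ennreal (real (2 * m - 1)) * indicator {m. zero_level c n l x m} m)"
proof -
  let ?S = "{m \<in> {1..n}. zero_level c n l x m}"
  have "(level_count c n l x)\<^sup>2 = of_nat ((card ?S)\<^sup>2)" by (simp add: level_count_def)
  also have "\<dots> \<le> of_nat (\<Sum>m\<in>?S. 2 * m - 1)"
    by (intro of_nat_mono card_power2_le_sum_odd) auto
  also have "\<dots> = (\<Sum>m\<in>?S. ennreal (real (2 * m - 1)))"
    unfolding of_nat_sum by (simp only: ennreal_of_nat_eq_real_of_nat)
  also have "\<dots> = (\<Sum>m = 1..n. if m \<in> {m. zero_level c n l x m} then ennreal (real (2 * m - 1)) else 0)"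
    by (subst sum.inter_filter[symmetric]) auto
  also have "\<dots> = (\<Sum>m = 1..n. ennreal (real (2 * m - 1)) * indicator {m. zero_level c n l x m} m)"
    by (intro sum.cong) (auto simp: indicator_def)
  finally show ?thesis .
qed

lemma sum_odd: "(\<Sum>m = 1..n. real (2 * m - 1)) = (real n)\<^sup>2"
  by (induction n) (auto simp: power2_eq_square algebra_simps)

lemma weighted_level_sum_bounded:
  assumes C: "C \<ge> 0"
  shows "\<exists>K\<ge>0. \<forall>n\<ge>1. (\<Sum>m = 1..n. real (2 * m - 1) * (4 / 3 * (1 / 4) ^ m + C * ((level_bound m)\<^sup>2 + 1 / (real n)\<^sup>2))) \<le> K"
proof -
  \<comment> \<open>Summable majorant of the part independent of \<open>n\<close>. With
    \<open>2 * m - 1 \<le> 2 * 2 ^ m\<close> the ratio 1/4 becomes 1/2 and \<open>4 * pi\<close>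
    becomes \<open>8 * pi\<close>; 4/3 is rounded up to 2.\<close>
  define D where "D m = 4 * (1/2) ^ m + 2 * C * exp (8 * pi) * ((8 * pi) ^ m /\<^sub>R fact m)" for m :: nat
  have D0: "0 \<le> D m" for m unfolding D_def using C by simp
  have sD: "summable D" unfolding D_def
    by (intro summable_add summable_mult summable_exp_generic) (simp add: summable_geometric)
  have le: "real (2 * m - 1) * (4 / 3 * (1 / 4) ^ m + C * (level_bound m)\<^sup>2) \<le> D m" for m
  proof -
    have "m \<le> 2 ^ m" by (rule less_imp_le[OF less_exp])
    then have "real m \<le> 2 ^ m" by (metis of_nat_le_iff of_nat_numeral of_nat_power)
    moreover have "real (2 * m - 1) \<le> real (2 * m)" by (rule of_nat_mono) simp
    moreover have "real (2 * m) = 2 * real m" by simp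
    ultimately have a: "real (2 * m - 1) \<le> 2 * 2 ^ m" by linarith
    define e where "e = (4 * pi) ^ m / (fact m :: real)"
    have e0: "0 \<le> e" by (simp add: e_def)
    \<comment> \<open>\<open>e\<close> is one term of the series of \<open>exp (4 * pi)\<close>.
      Bounding one of the two factors \<open>e\<close> in the square of \<open>level_bound m\<close>
      in this way leaves an exponential series.\<close>
    have e1: "e \<le> exp (4 * pi)"
    proof -
      have "(\<Sum>i\<in>{m}. (4 * pi) ^ i /\<^sub>R fact i) \<le> (\<Sum>i. (4 * pi) ^ i /\<^sub>R fact i)"
        by (intro sum_le_suminf summable_exp_generic) auto
      also have "\<dots> = exp (4 * pi)" by (simp add: exp_def)
      finally show ?thesis by (simp add: e_def divide_inverse mult.commute)
    qed
    have "(level_bound m)\<^sup>2 = exp (4 * pi) * (e * e)"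
    proof -
      have "level_bound m = exp (2 * pi) * e" by (simp add: level_bound_def e_def)
      moreover have "exp (2 * pi) * exp (2 * pi) = exp (4 * pi)" by (simp flip: exp_add)
      ultimately show ?thesis by (simp add: power2_eq_square mult_ac)
    qed
    also have "\<dots> \<le> exp (4 * pi) * (exp (4 * pi) * e)"
      using e0 e1 by (intro mult_left_mono mult_right_mono) auto
    also have "\<dots> = exp (8 * pi) * e" by (simp flip: exp_add add: mult.assoc[symmetric])
    finally have lb: "(level_bound m)\<^sup>2 \<le> exp (8 * pi) * e" .
    have "real (2 * m - 1) * (4 / 3 * (1 / 4) ^ m + C * (level_bound m)\<^sup>2) \<le>
        (2 * 2 ^ m) * (2 * (1 / 4) ^ m + C * (exp (8 * pi) * e))"
      using C lb by (intro mult_mono a add_mono mult_right_mono mult_left_mono) auto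
    also have "\<dots> = 4 * (2 ^ m * (1 / 4) ^ m) + 2 * C * exp (8 * pi) * (2 ^ m * e)" by (simp add: algebra_simps)
    also have "2 ^ m * (1 / 4) ^ m = (1 / 2 :: real) ^ m" by (simp flip: power_mult_distrib)
    also have "2 ^ m * e = (8 * pi) ^ m /\<^sub>R fact m"
    proof -
      have "(8 * pi) ^ m = 2 ^ m * (4 * pi) ^ m" using power_mult_distrib[of 2 "4 * pi" m] by simp
      then show ?thesis by (simp add: e_def divide_inverse mult_ac)
    qed
    finally show ?thesis by (simp add: D_def)
  qed
  show ?thesis
  proof (intro exI[of _ "suminf D + C"] conjI allI impI)
    show "0 \<le> suminf D + C" using suminf_nonneg[OF sD D0] C by simp
    fix n :: nat assume n: "n \<ge> 1"
    have "(\<Sum>m = 1..n. real (2 * m - 1) * (4 / 3 * (1 / 4) ^ m + C * ((level_bound m)\<^sup>2 + 1 / (real n)\<^sup>2))) =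
       (\<Sum>m = 1..n. real (2 * m - 1) * (4 / 3 * (1 / 4) ^ m + C * (level_bound m)\<^sup>2)) + (\<Sum>m = 1..n. real (2 * m - 1)) * (C / (real n)\<^sup>2)"
      unfolding sum_distrib_right sum.distrib[symmetric] by (intro sum.cong refl) (simp add: algebra_simps)
    also have "\<dots> \<le> (\<Sum>m = 1..n. D m) + C"
    proof (intro add_mono sum_mono le)
      show "(\<Sum>m = 1..n. real (2 * m - 1)) * (C / (real n)\<^sup>2) \<le> C" unfolding sum_odd using n by simp
    qed
    also have "(\<Sum>m = 1..n. D m) \<le> suminf D"
      by (intro sum_le_suminf sD D0) auto
    finally show "(\<Sum>m = 1..n. real (2 * m - 1) * (4 / 3 * (1 / 4) ^ m + C * ((level_bound m)\<^sup>2 + 1 / (real n)\<^sup>2))) \<le> suminf D + C"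
      by simp
  qed
qed

section \<open>Random coefficients: moments and probabilities of levels\<close>

locale iid_coefficients = prob_space M for M :: "'w measure" +
  fixes a :: "nat \<Rightarrow> nat \<Rightarrow> 'w \<Rightarrow> real"
  assumes indep: "indep_vars (\<lambda>_. borel) (\<lambda>(k, l). a k l) ({1..} \<times> {1..})"
    and same_distr: "\<And>k l. k \<ge> 1 \<Longrightarrow> l \<ge> 1 \<Longrightarrow> distr M borel (a k l) = distr M borel (a 1 1)"
    and mean_zero: "expectation (a 1 1) = 0"
    and second_moment: "expectation (\<lambda>\<omega>. (a 1 1 \<omega>)\<^sup>2) = 1"
begin

lemma rv: "k \<ge> 1 \<Longrightarrow> l \<ge> 1 \<Longrightarrow> random_variable borel (a k l)"
  using indep unfolding indep_vars_def by auto

lemma moments: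
  assumes kl: "k \<ge> 1" "l \<ge> 1"
  shows "expectation (a k l) = 0" "expectation (\<lambda>\<omega>. (a k l \<omega>)\<^sup>2) = 1"
    "integrable M (a k l)" "integrable M (\<lambda>\<omega>. (a k l \<omega>)\<^sup>2)"
proof -
  have "expectation (a k l) = (\<integral>z. z \<partial>distr M borel (a k l))"
    by (rule integral_distr[OF rv[OF kl], symmetric]) simp
  also have "\<dots> = expectation (a 1 1)"
    unfolding same_distr[OF kl] by (rule integral_distr[OF rv[OF order_refl order_refl]]) simp
  finally show "expectation (a k l) = 0" unfolding mean_zero .
  have "expectation (\<lambda>\<omega>. (a k l \<omega>)\<^sup>2) = (\<integral>z. z\<^sup>2 \<partial>distr M borel (a k l))"
    by (rule integral_distr[OF rv[OF kl], symmetric]) simp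
  also have "\<dots> = expectation (\<lambda>\<omega>. (a 1 1 \<omega>)\<^sup>2)"
    unfolding same_distr[OF kl] by (rule integral_distr[OF rv[OF order_refl order_refl]]) simp
  finally show E2: "expectation (\<lambda>\<omega>. (a k l \<omega>)\<^sup>2) = 1" unfolding second_moment .
  show int2: "integrable M (\<lambda>\<omega>. (a k l \<omega>)\<^sup>2)"
    by (rule ccontr) (use E2 not_integrable_integral_eq in force)
  show "integrable M (a k l)" by (rule square_integrable_imp_integrable[OF rv[OF kl] int2])
qed

lemma second_moment_sum:
  fixes w :: "nat \<times> nat \<Rightarrow> real"
  assumes A: "finite A" "A \<subseteq> {1..} \<times> {1..}"
  shows "integrable M (\<lambda>\<omega>. (\<Sum>p\<in>A. w p * a (fst p) (snd p) \<omega>)\<^sup>2)"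
    "expectation (\<lambda>\<omega>. (\<Sum>p\<in>A. w p * a (fst p) (snd p) \<omega>)\<^sup>2) = (\<Sum>p\<in>A. (w p)\<^sup>2)"
proof -
  let ?X = "\<lambda>p. a (fst p) (snd p)"
  have X1: "1 \<le> fst p" "1 \<le> snd p" if "p \<in> A" for p using A(2) that by auto
  have ind: "indep_vars (\<lambda>_. borel) ?X A"
    using indep_vars_subset[OF indep A(2)] by (simp only: case_prod_beta')
  have prod: "integrable M (\<lambda>\<omega>. ?X p \<omega> * ?X q \<omega>) \<and> expectation (\<lambda>\<omega>. ?X p \<omega> * ?X q \<omega>) = (if p = q then 1 else 0)"
    if pq: "p \<in> A" "q \<in> A" for p q
  proof (cases "p = q")
    case True
    then show ?thesis using moments(2,4)[OF X1[OF pq(1)]] by (simp add: power2_eq_square)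
  next
    case False
    have ind2: "indep_vars (\<lambda>_. borel) ?X {p, q}" using indep_vars_subset[OF ind, of "{p, q}"] pq by simp
    have i: "integrable M (?X r)" if "r \<in> {p, q}" for r
      using that moments(3)[OF X1[OF pq(1)]] moments(3)[OF X1[OF pq(2)]] by auto
    show ?thesis
      using indep_vars_lebesgue_integral[OF _ ind2 i] indep_vars_integrable[OF _ ind2 i] False
        moments(1)[OF X1[OF pq(1)]] by simp
  qed
  have sq: "(\<Sum>p\<in>A. w p * ?X p \<omega>)\<^sup>2 = (\<Sum>p\<in>A. \<Sum>q\<in>A. (w p * w q) * (?X p \<omega> * ?X q \<omega>))" for \<omega>
    unfolding power2_eq_square sum_product by (intro sum.cong refl) (simp only: mult_ac)
  show "integrable M (\<lambda>\<omega>. (\<Sum>p\<in>A. w p * ?X p \<omega>)\<^sup>2)"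
    unfolding sq using prod by (intro Bochner_Integration.integrable_sum integrable_mult_right) auto
  have "expectation (\<lambda>\<omega>. (\<Sum>p\<in>A. w p * ?X p \<omega>)\<^sup>2) =
      (\<Sum>p\<in>A. \<Sum>q\<in>A. expectation (\<lambda>\<omega>. (w p * w q) * (?X p \<omega> * ?X q \<omega>)))"
    unfolding sq using prod
    by (subst Bochner_Integration.integral_sum; (intro sum.cong refl Bochner_Integration.integral_sum)?)
      (auto intro!: Bochner_Integration.integrable_sum)
  also have "\<dots> = (\<Sum>p\<in>A. \<Sum>q\<in>A. if p = q then w p * w q else 0)"
    using prod by (intro sum.cong refl) auto
  also have "\<dots> = (\<Sum>p\<in>A. (w p)\<^sup>2)" using A(1) by (simp add: power2_eq_square)
  finally show "expectation (\<lambda>\<omega>. (\<Sum>p\<in>A. w p * ?X p \<omega>)\<^sup>2) = (\<Sum>p\<in>A. (w p)\<^sup>2)" .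
qed

abbreviation G :: "nat \<Rightarrow> nat \<Rightarrow> real \<Rightarrow> real \<Rightarrow> 'w \<Rightarrow> real" where
  "G n m x y \<omega> \<equiv> cos_sum_deriv (line_coeff (\<lambda>i j. a i j \<omega>) n x) n m y"

text \<open>There are \<open>n^2\<close> orthonormal coefficients with weights at most
  \<open>1 / n\<close>. Scaling the frequencies to \<open>j / n \<le> 1\<close> makes the bound
  uniform in the order \<open>m\<close> of the derivative.\<close>

lemma G_second_moment:
  assumes n: "n \<ge> 1"
  shows "integrable M (\<lambda>\<omega>. (G n m x y \<omega>)\<^sup>2)" "expectation (\<lambda>\<omega>. (G n m x y \<omega>)\<^sup>2) \<le> 1"
proof -
  let ?v = "\<lambda>p. cos (real (fst p) * x / real n) * ((real (snd p) / real n) ^ m * cos (real (snd p) * y / real n + real m * pi / 2))"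
  let ?w = "\<lambda>p. 1 / real n * ?v p"
  note sm = second_moment_sum[of "{1..n} \<times> {1..n}" ?w]
  show "integrable M (\<lambda>\<omega>. (G n m x y \<omega>)\<^sup>2)"
    unfolding cos_sum_deriv_line_coeff_eq by (rule sm) auto
  have "expectation (\<lambda>\<omega>. (G n m x y \<omega>)\<^sup>2) = (\<Sum>p\<in>{1..n} \<times> {1..n}. (?w p)\<^sup>2)"
    unfolding cos_sum_deriv_line_coeff_eq by (rule sm) auto
  also have "\<dots> \<le> (\<Sum>p\<in>{1..n} \<times> {1..n}. (1 / real n)\<^sup>2)"
  proof (rule sum_mono)
    fix p assume p: "p \<in> {1..n} \<times> {1..n}"
    have "(real (snd p) / real n) ^ m \<le> 1" using p by (intro power_le_one) auto
    then have "\<bar>?v p\<bar> \<le> 1 * (1 * 1)"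
      unfolding abs_mult by (intro mult_mono) auto
    then have "(?v p)\<^sup>2 \<le> 1" by (simp add: abs_square_le_1)
    then have "(1 / real n)\<^sup>2 * (?v p)\<^sup>2 \<le> (1 / real n)\<^sup>2 * 1" by (intro mult_left_mono) auto
    then show "(?w p)\<^sup>2 \<le> (1 / real n)\<^sup>2" unfolding power_mult_distrib[of "1 / real n"] by simp
  qed
  also have "\<dots> = 1" using n by (simp add: card_cartesian_product power2_eq_square)
  finally show "expectation (\<lambda>\<omega>. (G n m x y \<omega>)\<^sup>2) \<le> 1" .
qed

lemma G_measurable_pair: "(\<lambda>z. G n m (snd z) y (fst z)) \<in> borel_measurable (M \<Otimes>\<^sub>M lborel)"
  unfolding cos_sum_deriv_line_coeff_eq
proof (intro borel_measurable_sum borel_measurable_times)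
  fix p assume p: "p \<in> {1..n} \<times> {1..n}"
  then have "random_variable borel (a (fst p) (snd p))" by (intro rv) auto
  then show "(\<lambda>z. a (fst p) (snd p) (fst z)) \<in> borel_measurable (M \<Otimes>\<^sub>M lborel)" by measurable
  have "(\<lambda>x. cos (real (fst p) * x / real n)) \<in> borel_measurable lborel" by measurable
  then show "(\<lambda>z. cos (real (fst p) * snd z / real n)) \<in> borel_measurable (M \<Otimes>\<^sub>M lborel)" by measurable
qed auto

lemma G_measurable: "random_variable borel (G n m x y)"
  unfolding cos_sum_deriv_line_coeff_eq
  by (intro borel_measurable_sum borel_measurable_times borel_measurable_const rv) auto

lemma zero_level_measurable_pair:
  "Measurable.pred (M \<Otimes>\<^sub>M lborel) (\<lambda>z. zero_level (\<lambda>i j. a i j (fst z)) n l (snd z) m)"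
  unfolding zero_level_def using G_measurable_pair[measurable] by measurable

lemma zero_level_events: "{\<omega> \<in> space M. zero_level (\<lambda>i j. a i j \<omega>) n l x m} \<in> events"
  unfolding zero_level_def using G_measurable[measurable] by measurable

lemma small_ball:
  obtains C where "C \<ge> 0" "\<And>n l x r. n \<ge> 1 \<Longrightarrow> l \<le> n - 1 \<Longrightarrow> r \<ge> 0 \<Longrightarrow>
    prob {\<omega> \<in> space M. \<bar>G n 0 x (real l * pi) \<omega>\<bar> \<le> r \<and> \<bar>G n 0 x (real (Suc l) * pi) \<omega>\<bar> \<le> r} \<le> C * (r\<^sup>2 + 1 / (real n)\<^sup>2)"
proof -
  obtain s0 where s0: "s0 > 0" "\<And>t. \<bar>t\<bar> \<le> s0 \<Longrightarrow> cmod (char (distr M borel (a 1 1)) t) \<le> exp (- t\<^sup>2 / 4)"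
  proof (rule char_le_gaussian[OF rv[OF order_refl order_refl] mean_zero second_moment])
  qed blast
  \<comment> \<open>4096 * 576 / 7 comes from \<open>4096 * R^2 / Q\<close> and the Gram constant,
    the bracket from expanding \<open>R^2\<close> below.\<close>
  define K where "K = 4096 * 576 / 7 * (2 + 8 / s0\<^sup>2)"
  have K: "K \<ge> 4" unfolding K_def by (simp add: field_simps)
  show ?thesis
  proof (rule that[of K])
    show "K \<ge> 0" using K by simp
    fix n l :: nat and x r :: real assume n: "n \<ge> 1" and l: "l \<le> n - 1" and r: "r \<ge> 0"
    let ?S = "{\<omega> \<in> space M. \<bar>G n 0 x (real l * pi) \<omega>\<bar> \<le> r \<and> \<bar>G n 0 x (real (Suc l) * pi) \<omega>\<bar> \<le> r}"
    show "prob ?S \<le> K * (r\<^sup>2 + 1 / (real n)\<^sup>2)"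
    proof (cases "n \<ge> 3")
      \<comment> \<open>The Gram bound starts at \<open>n = 3\<close>; for smaller \<open>n\<close>
        the trivial bound 1 is at most \<open>4 / n^2\<close>.\<close>
      case False
      then have "n = 1 \<or> n = 2" using n by auto
      then have "1 \<le> 4 * (1 / (real n)\<^sup>2)" by auto
      also have "\<dots> \<le> K * (r\<^sup>2 + 1 / (real n)\<^sup>2)" using K by (intro mult_mono) auto
      finally show ?thesis using prob_le_1[of ?S] by linarith
    next
      case True
      define A where "A = {1..n} \<times> {1..n}"
      define X where "X p = a (fst p) (snd p)" for p
      define u where "u p = cos (real (fst p) * x / real n) * cos (real (snd p) * (real l * pi) / real n)" for p :: "nat \<times> nat"
      define v where "v p = cos (real (fst p) * x / real n) * cos (real (snd p) * (real (Suc l) * pi) / real n)" for p :: "nat \<times> nat"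
      \<comment> \<open>Multiplying by \<open>n\<close> removes the normalisation and turns
        \<open>r\<close> into \<open>n * r\<close>. The summand \<open>2 / s0\<close> enforces
        \<open>2 \<le> s0 * R\<close> even for \<open>r = 0\<close> and is the origin of the term
        \<open>1 / n^2\<close>.\<close>
      define R where "R = real n * r + 2 / s0"
      define Q where "Q = 7 / 576 * (real n)\<^sup>2"
      have ind: "indep_vars (\<lambda>_. borel) X A"
      proof -
        have "{1..n} \<times> {1..n} \<subseteq> {1..} \<times> {1..}" by auto
        from indep_vars_subset[OF indep this] show ?thesis
          unfolding X_def A_def by (simp only: case_prod_beta')
      qed
      have chr: "cmod (char (distr M borel (X p)) t) \<le> exp (- t\<^sup>2 / 4)" if "p \<in> A" "\<bar>t\<bar> \<le> s0" for p t
        using that s0(2)[of t] same_distr[of "fst p" "snd p"] unfolding X_def A_def by auto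
      have small: "\<bar>cos s * cos t\<bar> \<le> 1" for s t :: real
        using mult_mono[of "\<bar>cos s\<bar>" 1 "\<bar>cos t\<bar>" 1] by (simp add: abs_mult)
      have Q2: "Q * (s\<^sup>2 + t\<^sup>2) \<le> (\<Sum>p\<in>A. (s * u p + t * v p)\<^sup>2)" for s t
      proof -
        have "(\<Sum>p\<in>A. (s * u p + t * v p)\<^sup>2) = (\<Sum>i = 1..n. \<Sum>j = 1..n.
          (s * (cos (real i * x / real n) * cos (real j * (real l * pi) / real n)) +
           t * (cos (real i * x / real n) * cos (real j * (real (Suc l) * pi) / real n)))\<^sup>2)"
          unfolding A_def u_def v_def sum.cartesian_product by (simp only: case_prod_unfold)
        then show ?thesis using gram_lower[OF True, of l s t x] l True unfolding Q_def by simp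
      qed
      have R: "R > 0" "2 \<le> s0 * R" using s0(1) r by (auto simp: R_def distrib_left add_nonneg_pos)
      have Gu: "real n * G n 0 x (real l * pi) \<omega> = (\<Sum>p\<in>A. u p * X p \<omega>)" for \<omega>
        unfolding cos_sum_deriv_line_coeff_eq A_def u_def X_def sum_distrib_left using n
        by (intro sum.cong refl) simp
      have Gv: "real n * G n 0 x (real (Suc l) * pi) \<omega> = (\<Sum>p\<in>A. v p * X p \<omega>)" for \<omega>
        unfolding cos_sum_deriv_line_coeff_eq A_def v_def X_def sum_distrib_left using n
        by (intro sum.cong refl) simp
      let ?T = "{\<omega> \<in> space M. \<bar>\<Sum>p\<in>A. u p * X p \<omega>\<bar> \<le> R \<and> \<bar>\<Sum>p\<in>A. v p * X p \<omega>\<bar> \<le> R}"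
      have le: "\<bar>real n * z\<bar> \<le> R" if "\<bar>z\<bar> \<le> r" for z
      proof -
        have "real n * \<bar>z\<bar> \<le> real n * r" using that by (intro mult_left_mono) auto
        then show ?thesis using s0(1) by (simp add: abs_mult R_def add_increasing2)
      qed
      have "prob ?S \<le> prob ?T"
      proof (rule finite_measure_mono)
        show "?S \<subseteq> ?T" using le unfolding Gu[symmetric] Gv[symmetric] by blast
        show "?T \<in> events" unfolding Gu[symmetric] Gv[symmetric] using G_measurable[measurable] by measurable
      qed
      also have "\<dots> \<le> 4096 * R\<^sup>2 / Q"
        by (rule small_ball_pair[OF _ ind chr _ _ _ Q2 R]) (use n in \<open>auto simp: A_def u_def v_def Q_def small\<close>)
      also have "\<dots> = 4096 * 576 / 7 * (R\<^sup>2 / (real n)\<^sup>2)" by (simp add: Q_def)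
      also have "\<dots> \<le> K * (r\<^sup>2 + 1 / (real n)\<^sup>2)"
      proof -
        have "R\<^sup>2 \<le> 2 * (real n * r)\<^sup>2 + 2 * (2 / s0)\<^sup>2"
          unfolding R_def using zero_le_power2[of "real n * r - 2 / s0"] by (simp add: power2_eq_square algebra_simps)
        then have "R\<^sup>2 / (real n)\<^sup>2 \<le> (2 * (real n * r)\<^sup>2 + 2 * (2 / s0)\<^sup>2) / (real n)\<^sup>2"
          by (intro divide_right_mono) auto
        also have "\<dots> = 2 * r\<^sup>2 + (8 / s0\<^sup>2) * (1 / (real n)\<^sup>2)"
          using n by (simp add: add_divide_distrib power_mult_distrib power_divide)
        also have "\<dots> \<le> (2 + 8 / s0\<^sup>2) * r\<^sup>2 + (2 + 8 / s0\<^sup>2) * (1 / (real n)\<^sup>2)"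
          by (intro add_mono mult_right_mono) auto
        also have "\<dots> = (2 + 8 / s0\<^sup>2) * (r\<^sup>2 + 1 / (real n)\<^sup>2)" by (simp only: distrib_left)
        finally have "4096 * 576 / 7 * (R\<^sup>2 / (real n)\<^sup>2) \<le> 4096 * 576 / 7 * ((2 + 8 / s0\<^sup>2) * (r\<^sup>2 + 1 / (real n)\<^sup>2))"
          by (intro mult_left_mono) auto
        then show ?thesis unfolding K_def by (simp only: mult.assoc)
      qed
      finally show ?thesis .
    qed
  qed
qed

text \<open>Chebyshev's inequality for every order and a union bound. The thresholds grow fast
  enough in \<open>j\<close> for the probabilities to be summable, with sum \<open>4 / 3\<close>
  times the leading term, and slowly enough for the Taylor series to converge.\<close>

lemma prob_large_derivative:
  assumes n: "n \<ge> 1"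
  shows "prob {\<omega> \<in> space M. \<exists>j. \<bar>G n j x y \<omega>\<bar> > 2 ^ (m + j)} \<le> 4 / 3 * (1 / 4) ^ m"
proof -
  let ?A = "\<lambda>j. {\<omega> \<in> space M. \<bar>G n j x y \<omega>\<bar> \<ge> 2 ^ (m + j)}"
  have A: "?A j \<in> events" for j using G_measurable[measurable] by measurable
  have PA: "prob (?A j) \<le> (1 / 4) ^ m * (1 / 4) ^ j" for j
  proof -
    have "prob (?A j) \<le> expectation (\<lambda>\<omega>. (G n j x y \<omega>)\<^sup>2) / (2 ^ (m + j))\<^sup>2"
      by (rule second_moment_method[OF G_measurable G_second_moment(1)[OF n]]) simp
    also have "\<dots> \<le> 1 / (2 ^ (m + j))\<^sup>2" by (intro divide_right_mono G_second_moment n) simp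
    also have "\<dots> = (1 / 4) ^ m * (1 / 4) ^ j"
    proof -
      have "((2::real) ^ (m + j))\<^sup>2 = 4 ^ (m + j)"
        by (simp add: power2_eq_square flip: power_mult_distrib)
      then show ?thesis by (simp add: power_divide power_add)
    qed
    finally show ?thesis .
  qed
  have geo: "(\<lambda>j. (1 / 4) ^ m * (1 / 4 :: real) ^ j) sums ((1 / 4) ^ m * (1 / (1 - 1 / 4)))"
    by (intro sums_mult geometric_sums) simp
  have sum: "summable (\<lambda>j. prob (?A j))"
    by (rule summable_comparison_test_ev[OF always_eventually sums_summable[OF geo]]) (use PA in simp)
  have "prob {\<omega> \<in> space M. \<exists>j. \<bar>G n j x y \<omega>\<bar> > 2 ^ (m + j)} \<le> prob (\<Union>j. ?A j)"
    using A by (intro finite_measure_mono) (auto intro: less_imp_le)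
  also have "\<dots> \<le> (\<Sum>j. prob (?A j))"
    by (intro finite_measure_subadditive_countably sum) (use A in auto)
  also have "\<dots> \<le> (\<Sum>j. (1 / 4) ^ m * (1 / 4) ^ j)"
    by (intro suminf_le PA sum sums_summable[OF geo])
  also have "\<dots> = (1 / 4) ^ m * (1 / (1 - 1 / 4))" using geo by (rule sums_unique[symmetric])
  finally show ?thesis by simp
qed

text \<open>The weighted sum of level probabilities is bounded uniformly in \<open>x\<close>, so
  after Fubini the interval contributes only its length \<open>pi\<close>. Fubini is applied to a
  finite sum of indicators of levels.\<close>

lemma level_count_second_moment_bounded:
  obtains K where "K \<ge> 0" "\<And>n k l. n \<ge> 1 \<Longrightarrow> l \<le> n - 1 \<Longrightarrow>
    (\<integral>\<^sup>+\<omega>. (\<integral>\<^sup>+x\<in>{real k * pi..(real k + 1) * pi}. (level_count (\<lambda>i j. a i j \<omega>) n l x)\<^sup>2 \<partial>lborel) \<partial>M) \<le> ennreal K"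
proof -
  obtain C where C: "C \<ge> 0" "\<And>n l x r. n \<ge> 1 \<Longrightarrow> l \<le> n - 1 \<Longrightarrow> r \<ge> 0 \<Longrightarrow>
    prob {\<omega> \<in> space M. \<bar>G n 0 x (real l * pi) \<omega>\<bar> \<le> r \<and> \<bar>G n 0 x (real (Suc l) * pi) \<omega>\<bar> \<le> r} \<le> C * (r\<^sup>2 + 1 / (real n)\<^sup>2)"
  proof (rule small_ball)
  qed blast
  obtain K where K: "K \<ge> 0" "\<And>n. n \<ge> 1 \<Longrightarrow>
     (\<Sum>m = 1..n. real (2 * m - 1) * (4 / 3 * (1 / 4) ^ m + C * ((level_bound m)\<^sup>2 + 1 / (real n)\<^sup>2))) \<le> K"
    using weighted_level_sum_bounded[OF C(1)] by blast
  show ?thesis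
  proof (rule that[of "K * pi"])
    show "0 \<le> K * pi" using K(1) by simp
    fix n k l :: nat assume n: "n \<ge> 1" and l: "l \<le> n - 1"
    let ?J = "{real k * pi..(real k + 1) * pi}"
    let ?L = "\<lambda>\<omega> x m. zero_level (\<lambda>i j. a i j \<omega>) n l x m"
    have Pm: "emeasure M {\<omega> \<in> space M. ?L \<omega> x m} \<le>
        ennreal (4 / 3 * (1 / 4) ^ m + C * ((level_bound m)\<^sup>2 + 1 / (real n)\<^sup>2))" for x m
    proof -
      let ?A = "{\<omega> \<in> space M. \<exists>j. \<bar>G n j x (real l * pi) \<omega>\<bar> > 2 ^ (m + j)}"
      let ?B = "{\<omega> \<in> space M. \<bar>G n 0 x (real l * pi) \<omega>\<bar> \<le> level_bound m \<and> \<bar>G n 0 x (real (Suc l) * pi) \<omega>\<bar> \<le> level_bound m}"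
      have AB: "?A \<in> events" "?B \<in> events" using G_measurable[measurable] by measurable
      have "{\<omega> \<in> space M. ?L \<omega> x m} = ?A \<union> ?B" unfolding zero_level_def by auto
      then have "prob {\<omega> \<in> space M. ?L \<omega> x m} \<le> prob ?A + prob ?B"
        using measure_Un_le[OF AB] by simp
      also have "\<dots> \<le> 4 / 3 * (1 / 4) ^ m + C * ((level_bound m)\<^sup>2 + 1 / (real n)\<^sup>2)"
        by (intro add_mono prob_large_derivative n C(2) l) (simp add: level_bound_def)
      finally show ?thesis by (simp add: emeasure_eq_measure ennreal_leI)
    qed
    interpret pair: pair_sigma_finite M lborel by unfold_locales
    define f where "f \<omega> x = (\<Sum>m = 1..n. ennreal (real (2 * m - 1)) * indicator {m. ?L \<omega> x m} m) * indicator ?J x" for \<omega> x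
    have ind_eq: "indicator {m. ?L \<omega> x m} m = (if ?L \<omega> x m then 1 else 0 :: ennreal)" for \<omega> x m
      by (simp add: indicator_def)
    have f_meas: "case_prod f \<in> borel_measurable (M \<Otimes>\<^sub>M lborel)"
      unfolding f_def case_prod_beta' ind_eq using zero_level_measurable_pair[measurable] by measurable
    have "(\<integral>\<^sup>+\<omega>. (\<integral>\<^sup>+x\<in>?J. (level_count (\<lambda>i j. a i j \<omega>) n l x)\<^sup>2 \<partial>lborel) \<partial>M) \<le> (\<integral>\<^sup>+\<omega>. \<integral>\<^sup>+x. f \<omega> x \<partial>lborel \<partial>M)"
      unfolding f_def by (intro nn_integral_mono mult_right_mono level_count_power2_le) simp
    also have "\<dots> = (\<integral>\<^sup>+x. \<integral>\<^sup>+\<omega>. f \<omega> x \<partial>M \<partial>lborel)"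
      by (rule pair.Fubini'[OF f_meas, symmetric])
    also have "\<dots> \<le> (\<integral>\<^sup>+x. ennreal K * indicator ?J x \<partial>lborel)"
    proof (rule nn_integral_mono)
      fix x :: real
      have ev: "{\<omega> \<in> space M. ?L \<omega> x m} \<in> events" for m by (rule zero_level_events)
      have "(\<integral>\<^sup>+\<omega>. f \<omega> x \<partial>M) = (\<integral>\<^sup>+\<omega>. (\<Sum>m = 1..n. ennreal (real (2 * m - 1)) * indicator {\<omega> \<in> space M. ?L \<omega> x m} \<omega>) * indicator ?J x \<partial>M)"
        unfolding f_def by (intro nn_integral_cong arg_cong2[where f="(*)"] sum.cong refl) (simp add: indicator_def)
      also have "\<dots> = (\<Sum>m = 1..n. ennreal (real (2 * m - 1)) * emeasure M {\<omega> \<in> space M. ?L \<omega> x m}) * indicator ?J x"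
      proof -
        have "(\<integral>\<^sup>+\<omega>. (\<Sum>m = 1..n. ennreal (real (2 * m - 1)) * indicator {\<omega> \<in> space M. ?L \<omega> x m} \<omega>) \<partial>M) =
            (\<Sum>m = 1..n. \<integral>\<^sup>+\<omega>. ennreal (real (2 * m - 1)) * indicator {\<omega> \<in> space M. ?L \<omega> x m} \<omega> \<partial>M)"
          using ev by (intro nn_integral_sum) (auto intro!: borel_measurable_times borel_measurable_indicator)
        also have "\<dots> = (\<Sum>m = 1..n. ennreal (real (2 * m - 1)) * emeasure M {\<omega> \<in> space M. ?L \<omega> x m})"
          by (intro sum.cong refl nn_integral_cmult_indicator ev)
        finally show ?thesis
          using ev by (subst nn_integral_multc)
            (auto intro!: borel_measurable_sum borel_measurable_times borel_measurable_indicator simp del: sum_mult_indicator)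
      qed
      also have "\<dots> \<le> (\<Sum>m = 1..n. ennreal (real (2 * m - 1)) * ennreal (4 / 3 * (1 / 4) ^ m + C * ((level_bound m)\<^sup>2 + 1 / (real n)\<^sup>2))) * indicator ?J x"
        by (intro mult_right_mono sum_mono mult_left_mono Pm) auto
      also have "\<dots> = ennreal (\<Sum>m = 1..n. real (2 * m - 1) * (4 / 3 * (1 / 4) ^ m + C * ((level_bound m)\<^sup>2 + 1 / (real n)\<^sup>2))) * indicator ?J x"
        using C(1) by (subst sum_ennreal[symmetric]) (auto simp: ennreal_mult intro!: mult_nonneg_nonneg add_nonneg_nonneg)
      also have "\<dots> \<le> ennreal K * indicator ?J x"
        by (intro mult_right_mono ennreal_leI K(2) n) simp
      finally show "(\<integral>\<^sup>+\<omega>. f \<omega> x \<partial>M) \<le> ennreal K * indicator ?J x" .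
    qed
    also have "\<dots> = ennreal (K * pi)"
      using K(1) by (simp add: nn_integral_cmult_indicator ennreal_mult algebra_simps)
    finally show "(\<integral>\<^sup>+\<omega>. (\<integral>\<^sup>+x\<in>?J. (level_count (\<lambda>i j. a i j \<omega>) n l x)\<^sup>2 \<partial>lborel) \<partial>M) \<le> ennreal (K * pi)" .
  qed
qed

section \<open>Integrating over slices and exchanging the axes\<close>

lemma level_count_measurable_pair:
  "(\<lambda>z. level_count (\<lambda>i j. a i j (fst z)) n l (snd z)) \<in> borel_measurable (M \<Otimes>\<^sub>M lborel)"
proof -
  have eq: "level_count c n l x = (\<Sum>m = 1..n. if zero_level c n l x m then 1 else 0)" for c x
    unfolding level_count_def by (simp add: sum.If_cases Int_def)
  show ?thesis unfolding eq using zero_level_measurable_pair[measurable] by measurable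
qed

text \<open>Cauchy-Schwarz against the indicator of an interval of length \<open>pi\<close>;
  repeating this indicator in the integrand localises both factors.\<close>

lemma integral_level_count_power2_le:
  assumes \<omega>: "\<omega> \<in> space M"
  shows "(\<integral>\<^sup>+x\<in>{real k * pi..(real k + 1) * pi}. level_count (\<lambda>i j. a i j \<omega>) n l x \<partial>lborel)\<^sup>2 \<le>
    ennreal pi * (\<integral>\<^sup>+x\<in>{real k * pi..(real k + 1) * pi}. (level_count (\<lambda>i j. a i j \<omega>) n l x)\<^sup>2 \<partial>lborel)"
proof -
  let ?J = "{real k * pi..(real k + 1) * pi}" and ?f = "\<lambda>x. level_count (\<lambda>i j. a i j \<omega>) n l x"
  have [measurable]: "?f \<in> borel_measurable lborel"
    using measurable_compose[OF measurable_Pair1'[OF \<omega>] level_count_measurable_pair] by simp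
  have "(\<integral>\<^sup>+x. ?f x * indicator ?J x \<partial>lborel) = (\<integral>\<^sup>+x. (?f x * indicator ?J x) * indicator ?J x \<partial>lborel)"
    by (intro nn_integral_cong) (simp add: indicator_def)
  then have "(\<integral>\<^sup>+x. ?f x * indicator ?J x \<partial>lborel)\<^sup>2 \<le>
      (\<integral>\<^sup>+x. (?f x * indicator ?J x)\<^sup>2 \<partial>lborel) * (\<integral>\<^sup>+x. (indicator ?J x)\<^sup>2 \<partial>lborel)"
    using Cauchy_Schwarz_nn_integral[of "\<lambda>x. ?f x * indicator ?J x" lborel "indicator ?J"] by simp
  also have "(\<integral>\<^sup>+x. (?f x * indicator ?J x)\<^sup>2 \<partial>lborel) = (\<integral>\<^sup>+x. (?f x)\<^sup>2 * indicator ?J x \<partial>lborel)"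
    by (intro nn_integral_cong) (simp add: indicator_def)
  also have "(\<integral>\<^sup>+x. (indicator ?J x)\<^sup>2 \<partial>lborel) = (\<integral>\<^sup>+x. indicator ?J x \<partial>lborel)"
    by (intro nn_integral_cong) (simp add: indicator_def)
  also have "\<dots> = ennreal pi" by (simp add: algebra_simps)
  finally show ?thesis by (simp add: mult.commute)
qed

lemma measurable_integral_level_count_power2:
  "(\<lambda>\<omega>. \<integral>\<^sup>+x\<in>{real k * pi..(real k + 1) * pi}. (level_count (\<lambda>i j. a i j \<omega>) n l x)\<^sup>2 \<partial>lborel) \<in> borel_measurable M"
proof (rule lborel.borel_measurable_nn_integral)
  have "(\<lambda>z. (level_count (\<lambda>i j. a i j (fst z)) n l (snd z))\<^sup>2 * indicator {real k * pi..(real k + 1) * pi} (snd z))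
    \<in> borel_measurable (M \<Otimes>\<^sub>M lborel)"
    using level_count_measurable_pair[measurable] by measurable
  then show "(\<lambda>(\<omega>, x). (level_count (\<lambda>i j. a i j \<omega>) n l x)\<^sup>2 * indicator {real k * pi..(real k + 1) * pi} x)
    \<in> borel_measurable (M \<Otimes>\<^sub>M lborel)" by (simp add: case_prod_beta')
qed

text \<open>The hypotheses are symmetric in the two indices, so every probabilistic bound for
  vertical slices holds for horizontal ones.\<close>

lemma transpose: "iid_coefficients M (\<lambda>i j. a j i)"
proof
  have "prod.swap ` ({1..} \<times> {1..}) = ({1..} \<times> {1..} :: (nat \<times> nat) set)" by auto
  then have "indep_vars (\<lambda>_. borel) (\<lambda>p. (\<lambda>(k, l). a k l) (prod.swap p)) ({1..} \<times> {1..})"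
    using indep_vars_reindex[of "\<lambda>_. borel" "\<lambda>(k, l). a k l" prod.swap "{1..} \<times> {1..}"] indep by simp
  then show "indep_vars (\<lambda>_. borel) (\<lambda>(k, l). a l k) ({1..} \<times> {1..})" by (simp add: case_prod_beta')
  show "distr M borel (a l k) = distr M borel (a 1 1)" if "k \<ge> 1" "l \<ge> 1" for k l
    using same_distr[OF that(2,1)] .
qed (rule mean_zero second_moment)+

end

lemma ennreal_powr_two: "ennreal_powr x 2 = x\<^sup>2"
proof (cases x)
  case (real r)
  then show ?thesis by (simp add: ennreal_powr_def ennreal_power powr_numeral)
qed (simp add: ennreal_powr_def)

lemma power2_sum_le:
  fixes x y :: ennreal
  shows "(3 * x + 3 * y)\<^sup>2 \<le> 18 * (x\<^sup>2 + y\<^sup>2)"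
proof (cases "x = top \<or> y = top")
  case True
  then show ?thesis by (auto simp: ennreal_mult_top)
next
  case False
  then obtain r s where rs: "x = ennreal r" "y = ennreal s" "0 \<le> r" "0 \<le> s" by (cases x; cases y) auto
  have "(3 * r + 3 * s)\<^sup>2 \<le> 18 * (r\<^sup>2 + s\<^sup>2)"
    using zero_le_power2[of "r - s"] by (simp add: power2_eq_square algebra_simps)
  then have "ennreal ((3 * r + 3 * s)\<^sup>2) \<le> ennreal (18 * (r\<^sup>2 + s\<^sup>2))" by (rule ennreal_leI)
  then show ?thesis using rs by (simp add: ennreal_power[symmetric] ennreal_mult ennreal_plus)
qed

theorem proposition4:
  fixes M :: "'w measure" and a :: "nat \<Rightarrow> nat \<Rightarrow> 'w \<Rightarrow> real"
  assumes "prob_space M"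
    and "prob_space.indep_vars M (\<lambda>_. borel) (\<lambda>(k, l). a k l) ({1..} \<times> {1..})"
    and "\<And>k l. k \<ge> 1 \<Longrightarrow> l \<ge> 1 \<Longrightarrow> distr M borel (a k l) = distr M borel (a 1 1)"
    and "prob_space.expectation M (a 1 1) = 0"
    and "prob_space.expectation M (\<lambda>\<omega>. (a 1 1 \<omega>)\<^sup>2) = 1"
  shows "\<exists>\<alpha>::real. \<exists>C::real. \<alpha> > 0 \<and> C > 0 \<and>
    (SUP n \<in> {1..}. SUP k \<in> {0..n - 1}. SUP l \<in> {0..n - 1}.
       \<integral>\<^sup>+ \<omega> \<in> {\<omega> \<in> space M. \<exists>p. cos_poly (\<lambda>i j. a i j \<omega>) n p \<noteq> 0}.
         ennreal_powr (nodal_length (cos_poly (\<lambda>i j. a i j \<omega>) n) (pi_square k l)) (1 + \<alpha>) \<partial>M)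
    \<le> ennreal C"
proof -
  interpret A: iid_coefficients M a
    by (intro iid_coefficients.intro iid_coefficients_axioms.intro assms)
  interpret B: iid_coefficients M "\<lambda>i j. a j i" by (rule A.transpose)
  obtain K where K: "K \<ge> 0" "\<And>n k l. n \<ge> 1 \<Longrightarrow> l \<le> n - 1 \<Longrightarrow>
    (\<integral>\<^sup>+\<omega>. (\<integral>\<^sup>+x\<in>{real k * pi..(real k + 1) * pi}. (level_count (\<lambda>i j. a i j \<omega>) n l x)\<^sup>2 \<partial>lborel) \<partial>M) \<le> ennreal K"
  proof (rule A.level_count_second_moment_bounded)
  qed blast
  obtain L where L: "L \<ge> 0" "\<And>n k l. n \<ge> 1 \<Longrightarrow> l \<le> n - 1 \<Longrightarrow>
    (\<integral>\<^sup>+\<omega>. (\<integral>\<^sup>+x\<in>{real k * pi..(real k + 1) * pi}. (level_count (\<lambda>i j. a j i \<omega>) n l x)\<^sup>2 \<partial>lborel) \<partial>M) \<le> ennreal L"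
  proof (rule B.level_count_second_moment_bounded)
  qed blast
  \<comment> \<open>18 comes from squaring the two-term length bound and \<open>pi\<close> from
    Cauchy-Schwarz; adding 1 makes \<open>C\<close> positive even if \<open>K\<close> and
    \<open>L\<close> are 0.\<close>
  define C where "C = 18 * pi * (K + L) + 1"
  show ?thesis
  proof (rule exI[of _ 1], rule exI[of _ C], intro conjI SUP_least)
    show "C > 0" unfolding C_def using K(1) L(1) by (simp add: add_nonneg_pos)
    fix n k l :: nat assume "n \<in> {1..}" "k \<in> {0..n - 1}" "l \<in> {0..n - 1}"
    then have n: "n \<ge> 1" and k: "k \<le> n - 1" and l: "l \<le> n - 1" by auto
    let ?c = "\<lambda>\<omega> i j. a i j \<omega>" and ?d = "\<lambda>\<omega> i j. a j i \<omega>"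
    let ?J = "{real k * pi..(real k + 1) * pi}" and ?I = "{real l * pi..(real l + 1) * pi}"
    let ?N = "{\<omega> \<in> space M. \<exists>p. cos_poly (?c \<omega>) n p \<noteq> 0}"
    let ?U = "\<lambda>\<omega>. \<integral>\<^sup>+x\<in>?J. (level_count (?c \<omega>) n l x)\<^sup>2 \<partial>lborel"
    let ?V = "\<lambda>\<omega>. \<integral>\<^sup>+y\<in>?I. (level_count (?d \<omega>) n k y)\<^sup>2 \<partial>lborel"
    have "(\<integral>\<^sup>+ \<omega> \<in> ?N. ennreal_powr (nodal_length (cos_poly (?c \<omega>) n) (pi_square k l)) (1 + 1) \<partial>M) \<le>
        (\<integral>\<^sup>+ \<omega>. ennreal (18 * pi) * (?U \<omega> + ?V \<omega>) \<partial>M)"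
    \<comment> \<open>A pointwise comparison is enough here. Off \<open>?N\<close> the length is
      infinite, but the indicator makes the integrand 0.\<close>
    proof (rule nn_integral_mono)
      fix \<omega> assume \<omega>: "\<omega> \<in> space M"
      show "ennreal_powr (nodal_length (cos_poly (?c \<omega>) n) (pi_square k l)) (1 + 1) * indicator ?N \<omega> \<le>
          ennreal (18 * pi) * (?U \<omega> + ?V \<omega>)"
      proof (cases "\<omega> \<in> ?N")
        case True
        then have nz: "\<exists>p. cos_poly (?c \<omega>) n p \<noteq> 0" by simp
        let ?u = "\<integral>\<^sup>+x\<in>?J. level_count (?c \<omega>) n l x \<partial>lborel" and ?v = "\<integral>\<^sup>+y\<in>?I. level_count (?d \<omega>) n k y \<partial>lborel"
        have "ennreal_powr (nodal_length (cos_poly (?c \<omega>) n) (pi_square k l)) (1 + 1) =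
            (nodal_length (cos_poly (?c \<omega>) n) (pi_square k l))\<^sup>2"
          by (simp add: ennreal_powr_two)
        also have "\<dots> \<le> (3 * ?u + 3 * ?v)\<^sup>2" by (intro power_mono nodal_length_le n k l nz) simp
        also have "\<dots> \<le> 18 * (?u\<^sup>2 + ?v\<^sup>2)" by (rule power2_sum_le)
        also have "\<dots> \<le> 18 * (ennreal pi * ?U \<omega> + ennreal pi * ?V \<omega>)"
          by (intro mult_left_mono add_mono A.integral_level_count_power2_le B.integral_level_count_power2_le \<omega>) simp
        also have "\<dots> = ennreal (18 * pi) * (?U \<omega> + ?V \<omega>)"
          by (simp add: ennreal_mult distrib_left mult.assoc)
        finally show ?thesis using True by simp
      qed simp
    qed
    also have "\<dots> = ennreal (18 * pi) * ((\<integral>\<^sup>+\<omega>. ?U \<omega> \<partial>M) + (\<integral>\<^sup>+\<omega>. ?V \<omega> \<partial>M))"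
    proof -
      have UV: "?U \<in> borel_measurable M" "?V \<in> borel_measurable M"
        by (rule A.measurable_integral_level_count_power2 B.measurable_integral_level_count_power2)+
      have "(\<integral>\<^sup>+ \<omega>. ennreal (18 * pi) * (?U \<omega> + ?V \<omega>) \<partial>M) = ennreal (18 * pi) * (\<integral>\<^sup>+ \<omega>. ?U \<omega> + ?V \<omega> \<partial>M)"
        by (intro nn_integral_cmult borel_measurable_add UV)
      then show ?thesis unfolding nn_integral_add[OF UV] .
    qed
    also have "\<dots> \<le> ennreal (18 * pi) * (ennreal K + ennreal L)"
      by (intro mult_left_mono add_mono K(2) L(2) n k l) simp
    also have "\<dots> = ennreal (18 * pi * (K + L))" using K(1) L(1) by (simp add: ennreal_mult ennreal_plus)
    also have "\<dots> \<le> ennreal C" unfolding C_def by (intro ennreal_leI) simp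
    finally show "(\<integral>\<^sup>+ \<omega> \<in> ?N. ennreal_powr (nodal_length (cos_poly (?c \<omega>) n) (pi_square k l)) (1 + 1) \<partial>M) \<le> ennreal C" .
  qed simp
qed

end
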